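(* Let $m\ge1$ be an integer, and let $X_m(a,b)$ and $\widetilde X_m(a,b)$ be the elements of the free polynomial algebra $\mathbb{Q}\langle a,b\rangle$ in two noncommuting indeterminates defined by $$X_m(a,b)=\sum_{j=1}^{m-1}\frac{(-1)^j}{j}\sum_{\substack{\xi\subset\{1,\ldots,j\}\\ j+|\xi|\ge m}}y_{\xi,j}(a,b),$$ $$\widetilde X_m(a,b)=\sum_{j=1}^{m-1}\frac{(-1)^j}{j}\bigl((a+b+ab)^j-a^j-b^j\bigr),$$ with $y_{\xi,j}$ as in the context. (1) For every separable Hilbert space $\mathcal{H}$ and all trace class operators $A,B$ on $\mathcal{H}$ we have $$\operatorname{Tr}\bigl(X_m(A,B)\bigr)=\operatorname{Tr}\bigl(\widetilde X_m(A,B)\bigr).$$ (2) In the free polynomial $\mathbb{Q}$-algebra $\mathbb{Q}\langle a,b\rangle$ the difference $\widetilde X_m(a,b)-X_m(a,b)$ is a sum of commutators.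
   Context: For a subset $\xi\subset\{1,\ldots,j\}$ put $y_{\xi,j}^k(a,b)=ab$ if $k\in\xi$ and $y_{\xi,j}^k(a,b)=a+b$ if $k\in\{1,\ldots,j\}\setminus\xi$, and let $y_{\xi,j}(a,b)=\prod_{k=1}^j y_{\xi,j}^k(a,b)$, the product being taken in the order $k=1,2,\ldots,j$. $|\xi|$ denotes the cardinality of $\xi$. For $p\in\mathbb{Q}\langle a,b\rangle$, $p(A,B)$ is the operator obtained by inserting $A$ for $a$ and $B$ for $b$. $\operatorname{Tr}$ is the Hilbert space trace on trace class operators. A commutator is an element $[u,v]=uv-vu$ with $u,v\in\mathbb{Q}\langle a,b\rangle$; "sum of commutators" means an element of the linear span of the commutators. *)

theory Defs
  imports
    "HOL-Analysis.Analysis"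
    "HOL-Library.Poly_Mapping"
    "HOL-Library.Nonpos_Ints"
begin

section \<open>The free algebra on two noncommuting indeterminates\<close>

text \<open>
  The words over an alphabet form a (noncommutative) monoid, written additively because
  the convolution product on \<^type>\<open>poly_mapping\<close> expects its keys to be of class
  \<^class>\<open>monoid_add\<close>.  The free algebra is the monoid algebra of this monoid.
\<close>

datatype 'x free_monoid = Word (letters: "'x list")

instantiation free_monoid :: (type) monoid_add
begin

definition zero_free_monoid :: "'a free_monoid"
  where "0 = Word []"

definition plus_free_monoid :: "'a free_monoid \<Rightarrow> 'a free_monoid \<Rightarrow> 'a free_monoid"
  where "u + v = Word (letters u @ letters v)"

instance
  by standard (simp_all add: zero_free_monoid_def plus_free_monoid_def)

end

datatype indet = Ind_a | Ind_b

type_synonym ncpoly = "indet free_monoid \<Rightarrow>\<^sub>0 rat"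

definition var_a :: ncpoly
  where "var_a = Poly_Mapping.single (Word [Ind_a]) 1"

definition var_b :: ncpoly
  where "var_b = Poly_Mapping.single (Word [Ind_b]) 1"

definition scaleQ :: "rat \<Rightarrow> ncpoly \<Rightarrow> ncpoly"
  where "scaleQ c p = Poly_Mapping.map ((*) c) p"

lemma lookup_scaleQ: "Poly_Mapping.lookup (scaleQ c p) w = c * Poly_Mapping.lookup p w"
  by (simp add: scaleQ_def Poly_Mapping.map.rep_eq when_def)

global_interpretation ncpoly: vector_space scaleQ
  by standard (rule poly_mapping_eqI, simp add: lookup_scaleQ lookup_add algebra_simps)+

definition sums_of_commutators :: "ncpoly set"
  where "sums_of_commutators = ncpoly.span {u * v - v * u | u v. True}"

definition y_factor :: "nat set \<Rightarrow> nat \<Rightarrow> ncpoly"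
  where "y_factor \<xi> k = (if k \<in> \<xi> then var_a * var_b else var_a + var_b)"

definition y_poly :: "nat set \<Rightarrow> nat \<Rightarrow> ncpoly"
  where "y_poly \<xi> j = prod_list (map (y_factor \<xi>) [1..<Suc j])"

definition X_poly :: "nat \<Rightarrow> ncpoly"
  where "X_poly m =
    (\<Sum>j = 1..m - 1. scaleQ ((-1) ^ j / of_nat j)
       (\<Sum>\<xi> | \<xi> \<subseteq> {1..j} \<and> j + card \<xi> \<ge> m. y_poly \<xi> j))"

definition Xt_poly :: "nat \<Rightarrow> ncpoly"
  where "Xt_poly m =
    (\<Sum>j = 1..m - 1. scaleQ ((-1) ^ j / of_nat j)
       ((var_a + var_b + var_a * var_b) ^ j - var_a ^ j - var_b ^ j))"


section \<open>Complex Hilbert spaces\<close>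

class complex_vector = real_vector +
  fixes scaleC :: "complex \<Rightarrow> 'a \<Rightarrow> 'a"  (infixr \<open>*\<^sub>C\<close> 75)
  assumes scaleC_add_right: "c *\<^sub>C (x + y) = c *\<^sub>C x + c *\<^sub>C y"
    and scaleC_add_left: "(c + d) *\<^sub>C x = c *\<^sub>C x + d *\<^sub>C x"
    and scaleC_scaleC: "c *\<^sub>C d *\<^sub>C x = (c * d) *\<^sub>C x"
    and scaleC_one: "1 *\<^sub>C x = x"
    and scaleR_scaleC: "r *\<^sub>R x = complex_of_real r *\<^sub>C x"

global_interpretation complex_vector:
  vector_space "scaleC :: complex \<Rightarrow> 'a \<Rightarrow> 'a::complex_vector"
  by standard (rule scaleC_add_right scaleC_add_left scaleC_scaleC scaleC_one)+

text \<open>The inner product is antilinear in its first and linear in its second argument.\<close>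

class complex_inner = complex_vector + real_normed_vector +
  fixes cinner :: "'a \<Rightarrow> 'a \<Rightarrow> complex"
  assumes cinner_commute: "cinner x y = cnj (cinner y x)"
    and cinner_add_right: "cinner x (y + z) = cinner x y + cinner x z"
    and cinner_scaleC_right: "cinner x (c *\<^sub>C y) = c * cinner x y"
    and cinner_nonneg: "cinner x x \<in> \<real>\<^sub>\<ge>\<^sub>0"
    and cinner_eq_zero_iff: "cinner x x = 0 \<longleftrightarrow> x = 0"
    and norm_eq_sqrt_cinner: "norm x = sqrt (Re (cinner x x))"

class chilbert_space = complex_inner + complete_space

definition is_onb :: "'h::chilbert_space set \<Rightarrow> bool"
  where "is_onb E \<longleftrightarrow>
    (\<forall>e\<in>E. norm e = 1) \<and>
    (\<forall>e\<in>E. \<forall>f\<in>E. e \<noteq> f \<longrightarrow> cinner e f = 0) \<and>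
    closure (complex_vector.span E) = UNIV"


section \<open>Trace class operators and the trace\<close>

definition bounded_clinear :: "('h::chilbert_space \<Rightarrow> 'h) \<Rightarrow> bool"
  where "bounded_clinear T \<longleftrightarrow> bounded_linear T \<and> (\<forall>c x. T (c *\<^sub>C x) = c *\<^sub>C T x)"

text \<open>
  \<open>is_abs_op P T\<close> says that \<open>P = |T|\<close>, the positive square root of \<open>T\<^sup>* T\<close>:
  the last conjunct is \<open>P\<^sup>2 = T\<^sup>* T\<close> with the adjoint moved to the other side
  of the inner product.
\<close>

definition is_abs_op :: "('h::chilbert_space \<Rightarrow> 'h) \<Rightarrow> ('h \<Rightarrow> 'h) \<Rightarrow> bool"
  where "is_abs_op P T \<longleftrightarrow>
    bounded_clinear P \<and>
    (\<forall>x. cinner x (P x) \<in> \<real>\<^sub>\<ge>\<^sub>0) \<and>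
    (\<forall>x y. cinner x (P (P y)) = cinner (T x) (T y))"

definition trace_class :: "('h::chilbert_space \<Rightarrow> 'h) \<Rightarrow> bool"
  where "trace_class T \<longleftrightarrow>
    bounded_clinear T \<and>
    (\<exists>P E. is_abs_op P T \<and> is_onb E \<and> (\<lambda>e. cinner e (P e)) summable_on E)"

text \<open>
  The common value of \<open>\<Sum>\<^sub>e \<langle>e, T e\<rangle>\<close> over all orthonormal bases; it exists for every
  trace class operator \<open>T\<close>, and the definition is meant for such \<open>T\<close> only.
\<close>

definition Tr :: "('h::chilbert_space \<Rightarrow> 'h) \<Rightarrow> complex"
  where "Tr T = (THE t. \<forall>E. is_onb E \<longrightarrow> ((\<lambda>e. cinner e (T e)) has_sum t) E)"


section \<open>Inserting operators into noncommutative polynomials\<close>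

fun word_op :: "('h \<Rightarrow> 'h) \<Rightarrow> ('h \<Rightarrow> 'h) \<Rightarrow> indet list \<Rightarrow> 'h \<Rightarrow> 'h"
  where
    "word_op A B [] = id"
  | "word_op A B (Ind_a # w) = A \<circ> word_op A B w"
  | "word_op A B (Ind_b # w) = B \<circ> word_op A B w"

definition ncpoly_op :: "ncpoly \<Rightarrow> ('h::chilbert_space \<Rightarrow> 'h) \<Rightarrow> ('h \<Rightarrow> 'h) \<Rightarrow> 'h \<Rightarrow> 'h"
  where "ncpoly_op p A B x =
    (\<Sum>w\<in>Poly_Mapping.keys p.
       complex_of_real (of_rat (Poly_Mapping.lookup p w)) *\<^sub>C word_op A B (letters w) x)"

end

theory Submission
  imports Defs
begin

text \<open>
  Both parts rest on one algebraic fact: modulo commutators,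
  \<open>log ((1 + a) (1 + b)) = log (1 + a) + log (1 + b)\<close>, in every degree separately. Write
  \<open>s = a + b\<close> and \<open>p = a b\<close>, so that \<open>1 + s + p = (1 + a) (1 + b)\<close>. Expanding \<open>(s + p) ^ j\<close> gives
  the sum of all \<open>y_poly \<xi> j\<close> with \<open>\<xi> \<subseteq> {1..j}\<close>, each homogeneous of degree \<open>j + card \<xi>\<close>. Hence
  \<open>X_poly m\<close> removes from \<open>(s + p) ^ j\<close> the part of degree below \<open>m\<close>, and \<open>Xt_poly m - X_poly m\<close>
  collects the terms of degree below \<open>m\<close> of
  \<open>- log ((1 + a) (1 + b)) + log (1 + a) + log (1 + b)\<close>; powers with \<open>j \<ge> m\<close> have no such terms.

  The degrees are separated by a central variable \<open>X\<close>: put \<open>U = 1 + a X\<close>, \<open>V = 1 + b X\<close> and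
  \<open>Z = U V - 1\<close>, a power series over the free algebra. Now differentiate in \<open>X\<close>. Cyclic
  rotation turns \<open>(Z ^ j)'\<close> into \<open>j Z ^ (j - 1) Z'\<close>, so the
  derivative of the logarithm is congruent to the logarithmic derivative
  \<open>V\<inverse> U\<inverse> Z' = V\<inverse> U\<inverse> (a V + U b)\<close>, and one more rotation makes this \<open>U\<inverse> a + V\<inverse> b\<close>.
  Comparing coefficients (\<open>log_coefficient\<close>), with a division by the degree, proves part (2).

  Part (1) follows from part (2) once the trace of a product of trace class operators is known to be
  invariant under cyclic rotation and under the choice of orthonormal basis. Both are immediate for
  operators \<open>T x = (\<Sum>n. \<langle>u n, x\<rangle> v n)\<close> with \<open>(\<Sum>n. \<parallel>u n\<parallel> \<parallel>v n\<parallel>)\<close> finite: Parseval's identity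
  gives the trace as \<open>(\<Sum>n. \<langle>u n, v n\<rangle>)\<close> in every basis (\<open>nuclear_rep_trace\<close>), and the two orders of
  a product yield the same series (\<open>nuclear_trace_commute\<close>).

  The analytic core is that every trace class operator \<open>T\<close> has such a representation
  (\<open>trace_class_nuclear\<close>). Gaussian elimination along an orthonormal basis, that is, a Cholesky
  decomposition, writes \<open>P = |T|\<close> as a sum of rank one operators \<open>x \<mapsto> \<langle>P w n, x\<rangle> P w n\<close>, where
  \<open>(\<Sum>n. \<parallel>P w n\<parallel>\<^sup>2)\<close> is at most the trace of \<open>P\<close>.
  Applying the same elimination to \<open>T\<close> gives the terms \<open>\<langle>P w n, x\<rangle> T w n\<close>, and the remainders tend
  to \<open>0\<close> because \<open>\<parallel>T x\<parallel> = \<parallel>P x\<parallel>\<close>.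
\<close>

unbundle no vec_syntax
unbundle fps_syntax

section \<open>Expansion of a power of a sum\<close>

lemma binary_product_expansion:
  fixes x y :: "'a::semiring_1"
  shows "(x + y) ^ j =
    (\<Sum>\<xi>\<in>Pow {1..j}. prod_list (map (\<lambda>k. if k \<in> \<xi> then y else x) [1..<Suc j]))"
proof (induction j)
  case 0
  then show ?case by simp
next
  case (Suc j)
  define g where "g i \<xi> = prod_list (map (\<lambda>k. if k \<in> \<xi> then y else x) [1..<Suc i])" for i and \<xi> :: "nat set"
  have g_Suc: "g (Suc j) \<xi> = g j \<xi> * (if Suc j \<in> \<xi> then y else x)" for \<xi>
    by (simp add: g_def)
  have g_insert: "g j (insert (Suc j) \<xi>) = g j \<xi>" for \<xi>
    unfolding g_def by (rule arg_cong[where f=prod_list], rule map_cong) auto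
  have new: "Suc j \<notin> \<xi>" if "\<xi> \<in> Pow {1..j}" for \<xi>
    using that by auto
  have Pow_Suc: "Pow {1..Suc j} = Pow {1..j} \<union> insert (Suc j) ` Pow {1..j}"
    by (simp add: atLeastAtMostSuc_conv Pow_insert)
  have inj: "inj_on (insert (Suc j)) (Pow {1..j})"
    by (rule inj_onI) (metis new insert_ident)
  have "(\<Sum>\<xi>\<in>Pow {1..Suc j}. g (Suc j) \<xi>)
      = (\<Sum>\<xi>\<in>Pow {1..j}. g (Suc j) \<xi>) + (\<Sum>\<xi>\<in>insert (Suc j) ` Pow {1..j}. g (Suc j) \<xi>)"
    unfolding Pow_Suc by (rule sum.union_disjoint) auto
  also have "(\<Sum>\<xi>\<in>Pow {1..j}. g (Suc j) \<xi>) = (\<Sum>\<xi>\<in>Pow {1..j}. g j \<xi> * x)"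
    by (rule sum.cong) (auto simp: g_Suc)
  also have "(\<Sum>\<xi>\<in>insert (Suc j) ` Pow {1..j}. g (Suc j) \<xi>) = (\<Sum>\<xi>\<in>Pow {1..j}. g j \<xi> * y)"
    by (subst sum.reindex[OF inj]) (simp add: g_Suc g_insert)
  finally have "(\<Sum>\<xi>\<in>Pow {1..Suc j}. g (Suc j) \<xi>) = (\<Sum>\<xi>\<in>Pow {1..j}. g j \<xi>) * (x + y)"
    by (simp add: distrib_left sum_distrib_right)
  with Suc.IH show ?case
    by (simp only: g_def power_Suc2)
qed

section \<open>Congruence modulo commutators\<close>

definition comm_eq :: "ncpoly \<Rightarrow> ncpoly \<Rightarrow> bool"  (infix \<open>\<asymp>\<close> 50)
  where "p \<asymp> q \<longleftrightarrow> p - q \<in> sums_of_commutators"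

lemma comm_eq_refl: "p \<asymp> p"
  by (simp add: comm_eq_def sums_of_commutators_def ncpoly.span_zero)

lemma comm_eq_trans [trans]: "p \<asymp> q \<Longrightarrow> q \<asymp> r \<Longrightarrow> p \<asymp> r"
  unfolding comm_eq_def sums_of_commutators_def
  by (drule (1) ncpoly.span_add) simp

lemma comm_eq_add: "p \<asymp> q \<Longrightarrow> p' \<asymp> q' \<Longrightarrow> p + p' \<asymp> q + q'"
  unfolding comm_eq_def sums_of_commutators_def
  unfolding add_diff_add by (rule ncpoly.span_add)

lemma comm_eq_scaleQ: "p \<asymp> q \<Longrightarrow> scaleQ c p \<asymp> scaleQ c q"
  unfolding comm_eq_def sums_of_commutators_def
  unfolding ncpoly.scale_right_diff_distrib[symmetric] by (rule ncpoly.span_scale)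

lemma comm_eq_sum: "(\<And>i. i \<in> I \<Longrightarrow> f i \<asymp> g i) \<Longrightarrow> sum f I \<asymp> sum g I"
  unfolding comm_eq_def sums_of_commutators_def sum_subtractf[symmetric]
  by (rule ncpoly.span_sum)

lemma comm_eq_mult_commute: "u * v \<asymp> v * u"
  unfolding comm_eq_def sums_of_commutators_def by (rule ncpoly.span_base) blast

text \<open>
  Series multiply by convolution, so coefficientwise congruence still allows a product of two series
  to be rotated; this is what makes arguments with inverses and derivatives possible.
\<close>

definition comm_eq_series :: "ncpoly fps \<Rightarrow> ncpoly fps \<Rightarrow> bool"  (infix \<open>\<simeq>\<close> 50)
  where "f \<simeq> g \<longleftrightarrow> (\<forall>n. f $ n \<asymp> g $ n)"

lemma comm_eq_series_refl: "f \<simeq> f"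
  by (simp add: comm_eq_series_def comm_eq_refl)

lemma comm_eq_series_trans [trans]: "f \<simeq> g \<Longrightarrow> g \<simeq> h \<Longrightarrow> f \<simeq> h"
  unfolding comm_eq_series_def by (blast intro: comm_eq_trans)

lemma comm_eq_series_add: "f \<simeq> g \<Longrightarrow> f' \<simeq> g' \<Longrightarrow> f + f' \<simeq> g + g'"
  by (simp add: comm_eq_series_def comm_eq_add)

lemma comm_eq_series_mult_commute: "f * g \<simeq> g * f"
  unfolding comm_eq_series_def
proof
  fix n
  have "(f * g) $ n = (\<Sum>i=0..n. f $ i * g $ (n - i))"
    by (rule fps_mult_nth)
  also have "\<dots> \<asymp> (\<Sum>i=0..n. g $ (n - i) * f $ i)"
    by (intro comm_eq_sum comm_eq_mult_commute)
  also have "\<dots> = (g * f) $ n"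
    unfolding fps_mult_nth by (rule sum.reindex_bij_witness[of _ "\<lambda>i. n - i" "\<lambda>i. n - i"]) auto
  finally show "(f * g) $ n \<asymp> (g * f) $ n" .
qed

text \<open>
  The product rule gives \<open>j\<close> terms \<open>f ^ k * f' * f ^ l\<close> with \<open>k + l = j - 1\<close>, and rotation makes all of
  them equal. The factor \<open>f ^ i\<close> in front lets the induction absorb the left-hand power.
\<close>

lemma comm_eq_series_deriv_power_aux:
  "f ^ i * fps_deriv (f ^ j) \<simeq> of_nat j * (f ^ (i + j - 1) * fps_deriv f)"
proof (induction j arbitrary: i)
  case 0
  then show ?case by (simp add: comm_eq_series_refl)
next
  case (Suc j)
  have "f ^ i * fps_deriv (f ^ Suc j)
      = f ^ Suc i * fps_deriv (f ^ j) + (f ^ i * fps_deriv f) * f ^ j"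
    unfolding power_Suc2[of f i] power_Suc[of f j] fps_deriv_mult distrib_left
    by (simp only: mult.assoc)
  also have "\<dots> \<simeq> of_nat j * (f ^ (i + j) * fps_deriv f) + f ^ j * (f ^ i * fps_deriv f)"
    using comm_eq_series_add[OF Suc.IH[of "Suc i"] comm_eq_series_mult_commute] by simp
  also have "\<dots> = of_nat (Suc j) * (f ^ (i + Suc j - 1) * fps_deriv f)"
    by (simp add: distrib_right power_add[symmetric] mult.assoc[symmetric] add.commute)
  finally show ?case .
qed

lemma comm_eq_series_deriv_power:
  "fps_deriv (f ^ j) \<simeq> of_nat j * (f ^ (j - 1) * fps_deriv f)"
  using comm_eq_series_deriv_power_aux[of f 0 j] by simp

section \<open>Coefficients of the logarithm of a product\<close>

text \<open>
  The inverse of \<open>1 + x X\<close> as an explicit geometric series.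
\<close>

definition inv_one_plus :: "ncpoly \<Rightarrow> ncpoly fps"
  where "inv_one_plus x = Abs_fps (\<lambda>n. (- x) ^ n)"

lemma inv_one_plus_inverse: "inv_one_plus x * (1 + fps_const x * fps_X) = 1" "(1 + fps_const x * fps_X) * inv_one_plus x = 1"
proof -
  show "inv_one_plus x * (1 + fps_const x * fps_X) = 1"
  proof (rule fps_ext)
    fix n
    show "(inv_one_plus x * (1 + fps_const x * fps_X)) $ n = 1 $ n"
      by (cases n) (simp_all add: distrib_left inv_one_plus_def power_Suc2 flip: mult.assoc del: power_Suc)
  qed
  show "(1 + fps_const x * fps_X) * inv_one_plus x = 1"
  proof (rule fps_ext)
    fix n
    show "((1 + fps_const x * fps_X) * inv_one_plus x) $ n = 1 $ n"
      by (cases n) (simp_all add: distrib_right inv_one_plus_def mult.assoc)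
  qed
qed

text \<open>
  The series \<open>(1 + a X) (1 + b X) - 1\<close>, given by its coefficients: an indeterminate of the free
  algebra carries one factor \<open>X\<close>, so \<open>X\<close> records the degree.
\<close>

definition Z_series :: "ncpoly fps"
  where "Z_series = fps_const (var_a + var_b) * fps_X + fps_const (var_a * var_b) * fps_X ^ 2"

lemma one_plus_Z_series:
  "1 + Z_series = (1 + fps_const var_a * fps_X) * (1 + fps_const var_b * fps_X)"
proof -
  have X: "fps_X * fps_const c = fps_const c * fps_X" for c :: ncpoly
    by (rule fps_mult_fps_X_commute)
  have "fps_const var_a * fps_X * (fps_const var_b * fps_X)
      = fps_const var_a * (fps_X * fps_const var_b) * fps_X"
    by (simp only: mult.assoc)
  also have "\<dots> = fps_const var_a * fps_const var_b * fps_X ^ 2"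
    by (simp add: X mult.assoc power2_eq_square del: fps_const_mult)
  finally have "fps_const var_a * fps_X * (fps_const var_b * fps_X) = fps_const (var_a * var_b) * fps_X ^ 2"
    by simp
  then show ?thesis
    by (simp add: Z_series_def distrib_left distrib_right fps_const_add[symmetric] del: fps_const_add)
qed

text \<open>
  The logarithmic derivative of a product splits up to rotation. With \<open>U = 1 + a X\<close> and
  \<open>V = 1 + b X\<close> the left-hand side is \<open>V\<inverse> U\<inverse> (a V + U b)\<close>: in the second summand \<open>U\<close> cancels at once,
  and in the first \<open>V\<close> cancels after it has been moved to the front.
\<close>

lemma log_deriv_Z_series:
  "inv_one_plus var_b * inv_one_plus var_a * fps_deriv Z_series \<simeq>
     inv_one_plus var_a * fps_const var_a + inv_one_plus var_b * fps_const var_b"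
proof -
  define U V where "U = 1 + fps_const var_a * fps_X" and "V = 1 + fps_const var_b * fps_X"
  have "fps_deriv Z_series = fps_deriv (1 + Z_series)" by simp
  also have "\<dots> = U * fps_const var_b + fps_const var_a * V"
    unfolding one_plus_Z_series by (simp add: U_def V_def)
  finally have "inv_one_plus var_b * inv_one_plus var_a * fps_deriv Z_series
     = inv_one_plus var_b * ((inv_one_plus var_a * U) * fps_const var_b) + inv_one_plus var_b * (inv_one_plus var_a * fps_const var_a) * V"
    by (simp only: distrib_left mult.assoc)
  also have "\<dots> = inv_one_plus var_b * (inv_one_plus var_a * fps_const var_a) * V + inv_one_plus var_b * fps_const var_b"
    by (simp add: U_def inv_one_plus_inverse)
  also have "\<dots> \<simeq> V * (inv_one_plus var_b * (inv_one_plus var_a * fps_const var_a)) + inv_one_plus var_b * fps_const var_b"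
    by (rule comm_eq_series_add[OF comm_eq_series_mult_commute comm_eq_series_refl])
  also have "\<dots> = inv_one_plus var_a * fps_const var_a + inv_one_plus var_b * fps_const var_b"
    by (simp add: V_def inv_one_plus_inverse flip: mult.assoc)
  finally show ?thesis .
qed

text \<open>
  The logarithm is truncated to finitely many powers, so its derivative is a partial sum of the
  geometric series for \<open>(1 + Z)\<inverse> = V\<inverse> U\<inverse>\<close>; the error carries a high power of \<open>Z\<close>.
\<close>

lemma geometric_sum_Z_series:
  "(\<Sum>i<M. (- Z_series) ^ i) = inv_one_plus var_b * inv_one_plus var_a - (- Z_series) ^ M * (inv_one_plus var_b * inv_one_plus var_a)"
proof -
  \<comment> \<open>The factors are inverted in reverse order.\<close>
  define W where "W = inv_one_plus var_b * inv_one_plus var_a"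
  have W: "(1 + Z_series) * W = 1"
    unfolding one_plus_Z_series W_def
    by (metis inv_one_plus_inverse(2) mult.assoc mult_1_right)
  have "(\<Sum>i<M. (- Z_series) ^ i) * (1 + Z_series) = 1 - (- Z_series) ^ M"
  proof (induction M)
    case (Suc M)
    have "(\<Sum>i<Suc M. (- Z_series) ^ i) * (1 + Z_series)
        = (\<Sum>i<M. (- Z_series) ^ i) * (1 + Z_series) + (- Z_series) ^ M * (1 + Z_series)"
      by (simp only: sum.lessThan_Suc distrib_right)
    also have "\<dots> = 1 - (- Z_series) ^ M + ((- Z_series) ^ M + (- Z_series) ^ M * Z_series)"
      by (simp only: Suc.IH distrib_left[of "(- Z_series) ^ M"] mult_1_right)
    also have "\<dots> = 1 - (- Z_series) ^ Suc M"
      by (simp add: power_Suc2 del: power_Suc)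
    finally show ?case .
  qed simp
  then have "(\<Sum>i<M. (- Z_series) ^ i) * ((1 + Z_series) * W) = (1 - (- Z_series) ^ M) * W"
    by (simp flip: mult.assoc)
  then show ?thesis by (simp add: W left_diff_distrib flip: W_def)
qed

text \<open>
  \<open>Z\<close> is divisible by \<open>X\<close>, so its \<open>j\<close>-th power does not reach the coefficients below \<open>j\<close>.
\<close>

lemma Z_series_power_mult_nth: "n < j \<Longrightarrow> ((- Z_series) ^ j * f) $ n = 0"
proof (induction j arbitrary: n)
  case (Suc j)
  define g where "g = (- Z_series) ^ j * f"
  define K where "K = fps_const (var_a + var_b) + fps_X * fps_const (var_a * var_b)"
  have X: "fps_X * fps_const c = fps_const c * fps_X" for c :: ncpoly
    by (rule fps_mult_fps_X_commute)
  have "Z_series = K * fps_X"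
    unfolding Z_series_def K_def power2_eq_square distrib_right X by (simp only: mult.assoc)
  then have "Z_series * g = (fps_X * K) * g"
    by (simp only: fps_mult_fps_X_commute[of K])
  also have "\<dots> = fps_X * (K * g)"
    by (rule mult.assoc)
  also have "K * g = fps_const (var_a + var_b) * g + fps_X * (fps_const (var_a * var_b) * g)"
    by (simp only: K_def distrib_right mult.assoc)
  finally have "Z_series * g
      = fps_X * (fps_const (var_a + var_b) * g + fps_X * (fps_const (var_a * var_b) * g))" .
  moreover have "(- Z_series) ^ Suc j * f = - (Z_series * g)"
    by (simp add: g_def mult.assoc)
  moreover have "g $ i = 0" if "i < j" for i
    using Suc.IH[OF that] by (simp add: g_def)
  ultimately show ?case
    using Suc.prems by simp
qed simp

lemma of_nat_mult_ncpoly: "of_nat k * p = scaleQ (of_nat k) p"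
  by (induction k) (simp_all add: distrib_right ncpoly.scale_left_distrib)

lemma sign_mult_nth: "((- f) ^ i * g) $ n = scaleQ ((-1) ^ i) ((f ^ i * g) $ n)"
  by (cases "even i") simp_all

text \<open>
  The coefficient of degree \<open>d\<close> in \<open>- log (1 + Z) = - log (1 + a X) - log (1 + b X)\<close>, read modulo
  commutators. Both sides are compared through \<open>d\<close> times the coefficient, which is the coefficient of
  degree \<open>d - 1\<close> of the derivative; there the logarithm becomes a geometric series.
\<close>

lemma log_coefficient:
  assumes "1 \<le> d" "d \<le> M"
  shows "(\<Sum>j=1..M. scaleQ ((-1) ^ j / of_nat j) ((Z_series ^ j) $ d))
      \<asymp> scaleQ ((-1) ^ d / of_nat d) (var_a ^ d + var_b ^ d)"
proof -
  obtain e where d: "d = Suc e" using assms(1) by (cases d) auto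
  define D where "D = fps_deriv Z_series"
  define W where "W = inv_one_plus var_b * inv_one_plus var_a"
  have "scaleQ ((-1) ^ j / of_nat j) ((Z_series ^ j) $ d)
      \<asymp> scaleQ (- 1 / of_nat d) (((- Z_series) ^ (j - 1) * D) $ e)" if jM: "j \<in> {1..M}" for j
  proof -
    obtain i where j: "j = Suc i" using jM by (cases j) auto
    have "fps_deriv (Z_series ^ j) $ e = scaleQ (of_nat d) ((Z_series ^ j) $ d)"
      unfolding fps_deriv_nth of_nat_mult_ncpoly by (simp add: d)
    then have "scaleQ ((-1) ^ j / of_nat j) ((Z_series ^ j) $ d)
        = scaleQ ((-1) ^ j / (of_nat j * of_nat d)) (fps_deriv (Z_series ^ j) $ e)"
      by (simp add: d del: of_nat_Suc)
    also have "\<dots> \<asymp> scaleQ ((-1) ^ j / (of_nat j * of_nat d)) ((of_nat j * (Z_series ^ i * D)) $ e)"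
      using comm_eq_series_deriv_power[of Z_series j]
      by (intro comm_eq_scaleQ) (simp add: comm_eq_series_def D_def j del: of_nat_Suc power_Suc)
    also have "\<dots> = scaleQ (- 1 / of_nat d) (((- Z_series) ^ (j - 1) * D) $ e)"
      by (simp add: of_nat_mult_ncpoly sign_mult_nth j del: of_nat_Suc)
    finally show ?thesis .
  qed
  then have "(\<Sum>j=1..M. scaleQ ((-1) ^ j / of_nat j) ((Z_series ^ j) $ d))
      \<asymp> (\<Sum>j=1..M. scaleQ (- 1 / of_nat d) (((- Z_series) ^ (j - 1) * D) $ e))"
    by (rule comm_eq_sum)
  also have "\<dots> = (\<Sum>i<M. scaleQ (- 1 / of_nat d) (((- Z_series) ^ i * D) $ e))"
    by (rule sum.reindex_bij_witness[of _ Suc "\<lambda>j. j - 1"]) auto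
  also have "\<dots> = scaleQ (- 1 / of_nat d) (((\<Sum>i<M. (- Z_series) ^ i) * D) $ e)"
    by (simp only: ncpoly.scale_sum_right sum_distrib_right fps_sum_nth)
  also have "((\<Sum>i<M. (- Z_series) ^ i) * D) $ e = (W * D) $ e"
    using assms(2) unfolding geometric_sum_Z_series
    by (simp add: left_diff_distrib mult.assoc Z_series_power_mult_nth d flip: W_def)
  also have "scaleQ (- 1 / of_nat d) ((W * D) $ e) \<asymp>
      scaleQ (- 1 / of_nat d) ((inv_one_plus var_a * fps_const var_a + inv_one_plus var_b * fps_const var_b) $ e)"
    using log_deriv_Z_series by (intro comm_eq_scaleQ) (simp add: comm_eq_series_def W_def D_def)
  also have "\<dots> = scaleQ ((-1) ^ d / of_nat d) (var_a ^ d + var_b ^ d)"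
  proof -
    have "inv_one_plus x $ e * x = scaleQ ((-1) ^ e) (x ^ d)" for x
      by (cases "even e") (simp_all add: inv_one_plus_def d power_Suc2 del: power_Suc)
    then show ?thesis
      by (simp add: d ncpoly.scale_right_distrib del: of_nat_Suc)
  qed
  finally show ?thesis .
qed

section \<open>Low-degree parts of the powers\<close>

lemma y_poly_alt:
  "y_poly \<xi> j = prod_list (map (\<lambda>k. if k \<in> \<xi> then var_a * var_b else var_a + var_b) [1..<Suc j])"
  unfolding y_poly_def by (rule arg_cong[where f = prod_list], rule map_cong) (auto simp: y_factor_def)

text \<open>
  A factor \<open>(a + b) X\<close> contributes degree 1 and a factor \<open>a b X\<^sup>2\<close> contributes degree 2, which is why
  the choice \<open>\<xi>\<close> appears with \<open>X ^ (j + card \<xi>)\<close>.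
\<close>

lemma Z_series_power: "Z_series ^ j = (\<Sum>\<xi>\<in>Pow {1..j}. fps_const (y_poly \<xi> j) * fps_X ^ (j + card \<xi>))"
proof -
  have "prod_list (map (\<lambda>k. if k \<in> \<xi> then fps_const (var_a * var_b) * fps_X ^ 2
           else fps_const (var_a + var_b) * fps_X) [1..<Suc i])
      = fps_const (y_poly \<xi> i) * fps_X ^ (i + card (\<xi> \<inter> {1..i}))"
    (is "prod_list (map ?f _) = _") for \<xi> i
  proof (induction i)
    case 0
    then show ?case by (simp add: y_poly_def)
  next
    case (Suc i)
    have X: "fps_const p * fps_X ^ k * (fps_const q * fps_X ^ l) = fps_const (p * q) * fps_X ^ (k + l)"
      for p q :: ncpoly and k l
    proof -
      have "fps_const p * fps_X ^ k * (fps_const q * fps_X ^ l)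
          = fps_const p * (fps_X ^ k * fps_const q) * fps_X ^ l"
        by (simp only: mult.assoc)
      also have "\<dots> = fps_const p * (fps_const q * fps_X ^ k) * fps_X ^ l"
        by (simp only: fps_mult_fps_X_power_commute[of k "fps_const q"])
      also have "\<dots> = fps_const (p * q) * fps_X ^ (k + l)"
        by (simp only: fps_const_mult[symmetric] power_add mult.assoc)
      finally show ?thesis .
    qed
    have c: "card (\<xi> \<inter> {1..Suc i}) = card (\<xi> \<inter> {1..i}) + (if Suc i \<in> \<xi> then 1 else 0)"
      by (simp add: atLeastAtMostSuc_conv)
    have y: "y_poly \<xi> (Suc i) = y_poly \<xi> i * y_factor \<xi> (Suc i)"
      by (simp add: y_poly_def)
    have "prod_list (map ?f [1..<Suc (Suc i)]) = fps_const (y_poly \<xi> i) * fps_X ^ (i + card (\<xi> \<inter> {1..i})) * ?f (Suc i)"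
      using Suc.IH by simp
    also have "\<dots> = fps_const (y_poly \<xi> (Suc i)) * fps_X ^ (Suc i + card (\<xi> \<inter> {1..Suc i}))"
    proof (cases "Suc i \<in> \<xi>")
      case True
      then show ?thesis
        unfolding y c y_factor_def if_P[OF True] X by (simp add: add_ac)
    next
      case False
      then show ?thesis
        using X[of _ _ _ 1] unfolding y c y_factor_def if_not_P[OF False] by (simp only: power_one_right) (simp add: add_ac)
    qed
    finally show ?case .
  qed
  then have "Z_series ^ j = (\<Sum>\<xi>\<in>Pow {1..j}. fps_const (y_poly \<xi> j) * fps_X ^ (j + card (\<xi> \<inter> {1..j})))"
    unfolding Z_series_def binary_product_expansion by simp
  also have "\<dots> = (\<Sum>\<xi>\<in>Pow {1..j}. fps_const (y_poly \<xi> j) * fps_X ^ (j + card \<xi>))"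
    by (rule sum.cong) (auto simp: Int_absorb2)
  finally show ?thesis .
qed

lemma Z_series_power_nth: "(Z_series ^ j) $ d = (\<Sum>\<xi> | \<xi> \<subseteq> {1..j} \<and> j + card \<xi> = d. y_poly \<xi> j)"
proof -
  have "(fps_const p * fps_X ^ k) $ d = (if k = d then p else 0)" for p :: ncpoly and k
    by (simp add: fps_X_power_mult_right_nth)
  then have "(Z_series ^ j) $ d = (\<Sum>\<xi>\<in>Pow {1..j}. if j + card \<xi> = d then y_poly \<xi> j else 0)"
    by (simp only: Z_series_power fps_sum_nth)
  also have "\<dots> = (\<Sum>\<xi> \<in> {\<xi> \<in> Pow {1..j}. j + card \<xi> = d}. y_poly \<xi> j)"
    by (rule sum.inter_filter[symmetric]) simp
  also have "{\<xi> \<in> Pow {1..j}. j + card \<xi> = d} = {\<xi>. \<xi> \<subseteq> {1..j} \<and> j + card \<xi> = d}"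
    by auto
  finally show ?thesis .
qed

text \<open>
  The condition \<open>j + card \<xi> \<ge> m\<close> keeps the part of degree at least \<open>m\<close>, so what it leaves out of the
  full power consists of the homogeneous parts of degree below \<open>m\<close>. The degree 0 part is absent because
  \<open>j \<ge> 1\<close>.
\<close>

lemma low_degree_part:
  assumes "1 \<le> j"
  shows "(var_a + var_b + var_a * var_b) ^ j
      - (\<Sum>\<xi> | \<xi> \<subseteq> {1..j} \<and> j + card \<xi> \<ge> m. y_poly \<xi> j) = (\<Sum>d=1..m - 1. (Z_series ^ j) $ d)"
proof -
  have "(var_a + var_b + var_a * var_b) ^ j = (\<Sum>\<xi>\<in>Pow {1..j}. y_poly \<xi> j)"
    unfolding binary_product_expansion y_poly_alt ..
  also have "Pow {1..j} = {\<xi>. \<xi> \<subseteq> {1..j} \<and> j + card \<xi> \<ge> m} \<union> {\<xi>. \<xi> \<subseteq> {1..j} \<and> j + card \<xi> < m}"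
    by auto
  also have "(\<Sum>\<xi>\<in>\<dots>. y_poly \<xi> j) = (\<Sum>\<xi> | \<xi> \<subseteq> {1..j} \<and> j + card \<xi> \<ge> m. y_poly \<xi> j)
      + (\<Sum>\<xi> | \<xi> \<subseteq> {1..j} \<and> j + card \<xi> < m. y_poly \<xi> j)"
    by (rule sum.union_disjoint) auto
  also have "(\<Sum>\<xi> | \<xi> \<subseteq> {1..j} \<and> j + card \<xi> < m. y_poly \<xi> j)
      = (\<Sum>d=1..m - 1. \<Sum>\<xi> | \<xi> \<in> {\<xi>. \<xi> \<subseteq> {1..j} \<and> j + card \<xi> < m} \<and> j + card \<xi> = d. y_poly \<xi> j)"
    using assms by (intro sum.group[symmetric]) auto
  also have "\<dots> = (\<Sum>d=1..m - 1. (Z_series ^ j) $ d)"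
    unfolding Z_series_power_nth by (intro sum.cong refl arg_cong2[where f = sum]) auto
  finally show ?thesis by simp
qed

text \<open>
  Interchanging the sums over the power \<open>j\<close> and the degree \<open>d\<close> leaves, for every \<open>d < m\<close>, exactly the
  two sides of \<open>log_coefficient\<close>.
\<close>

lemma Xt_poly_comm_eq_X_poly: "Xt_poly m - X_poly m \<in> sums_of_commutators"
proof -
  define c :: "nat \<Rightarrow> rat" where "c j = (-1) ^ j / of_nat j" for j
  have "Xt_poly m - X_poly m
      = (\<Sum>j=1..m - 1. scaleQ (c j) ((var_a + var_b + var_a * var_b) ^ j - var_a ^ j - var_b ^ j
          - (\<Sum>\<xi> | \<xi> \<subseteq> {1..j} \<and> j + card \<xi> \<ge> m. y_poly \<xi> j)))"
    unfolding Xt_poly_def X_poly_def c_def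
    by (simp only: sum_subtractf ncpoly.scale_right_diff_distrib)
  also have "\<dots> = (\<Sum>j=1..m - 1. scaleQ (c j) ((\<Sum>d=1..m - 1. (Z_series ^ j) $ d) - (var_a ^ j + var_b ^ j)))"
  proof (intro sum.cong refl arg_cong[where f = "scaleQ _"])
    fix j assume "j \<in> {1..m - 1}"
    then have "1 \<le> j" by simp
    have rearrange: "p - q - r - s = (p - s) - (q + r)" for p q r s :: ncpoly
      by (simp add: algebra_simps)
    show "(var_a + var_b + var_a * var_b) ^ j - var_a ^ j - var_b ^ j
          - (\<Sum>\<xi> | \<xi> \<subseteq> {1..j} \<and> j + card \<xi> \<ge> m. y_poly \<xi> j)
        = (\<Sum>d=1..m - 1. (Z_series ^ j) $ d) - (var_a ^ j + var_b ^ j)"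
      unfolding rearrange low_degree_part[OF \<open>1 \<le> j\<close>] ..
  qed
  also have "\<dots> = (\<Sum>j=1..m - 1. \<Sum>d=1..m - 1. scaleQ (c j) ((Z_series ^ j) $ d))
      - (\<Sum>d=1..m - 1. scaleQ (c d) (var_a ^ d + var_b ^ d))"
    by (simp only: ncpoly.scale_right_diff_distrib ncpoly.scale_sum_right sum_subtractf)
  also have "\<dots> = (\<Sum>d=1..m - 1. \<Sum>j=1..m - 1. scaleQ (c j) ((Z_series ^ j) $ d))
      - (\<Sum>d=1..m - 1. scaleQ (c d) (var_a ^ d + var_b ^ d))"
    by (subst sum.swap) rule
  also have "\<dots> \<in> sums_of_commutators"
    unfolding comm_eq_def[symmetric] c_def by (intro comm_eq_sum log_coefficient) auto
  finally show ?thesis .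
qed

section \<open>Complex inner product spaces\<close>

text \<open>
  Possibly degenerate inner products: the Cauchy-Schwarz inequality is applied both to the inner
  product itself and to \<open>\<langle>x, Q y\<rangle>\<close> for a positive operator \<open>Q\<close>.
\<close>

definition positive_form :: "('a::complex_vector \<Rightarrow> 'a \<Rightarrow> complex) \<Rightarrow> bool"
  where "positive_form h \<longleftrightarrow>
    (\<forall>x y z. h x (y + z) = h x y + h x z) \<and> (\<forall>c x y. h x (c *\<^sub>C y) = c * h x y) \<and>
    (\<forall>x y. h x y = cnj (h y x)) \<and> (\<forall>x. 0 \<le> Re (h x x))"

lemma positive_form_Cauchy_Schwarz:
  assumes "positive_form h"
  shows "(cmod (h x y))\<^sup>2 \<le> Re (h x x) * Re (h y y)"
proof -
  from assms have add: "h u (v + w) = h u v + h u w" and scale: "h u (c *\<^sub>C v) = c * h u v"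
    and sym: "h u v = cnj (h v u)" and pos: "0 \<le> Re (h u u)" for u v w c
    unfolding positive_form_def by blast+
  define a where "a = (cmod (h x y))\<^sup>2"
  \<comment> \<open>Nonnegativity of the form at \<open>x - t \<langle>y, x\<rangle> y\<close>, whose phase makes the cross terms real.\<close>
  have quad: "0 \<le> Re (h x x) - 2 * t * a + t\<^sup>2 * a * Re (h y y)" for t :: real
  proof -
    define c where "c = - (of_real t * cnj (h x y))"
    define z where "z = x + c *\<^sub>C y"
    have "h z x = cnj (h x x) + cnj c * cnj (h x y)"
      by (subst sym) (simp add: z_def add scale)
    moreover have "h z y = cnj (h y x) + cnj c * cnj (h y y)"
      by (subst sym) (simp add: z_def add scale)
    moreover have "h z z = h z x + c * h z y"
      by (subst (2) z_def) (simp only: add scale)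
    moreover have "cnj (h x x) = h x x" "cnj (h y y) = h y y" "cnj (h y x) = h x y"
      using sym by metis+
    ultimately have "h z z = h x x + cnj (c * h x y) + c * h x y + c * cnj c * h y y"
      by (simp add: algebra_simps)
    moreover have "c * h x y = - (of_real t * (h x y * cnj (h x y)))"
      by (simp add: c_def mult_ac)
    moreover have "c * cnj c = (of_real t)\<^sup>2 * (h x y * cnj (h x y))"
      by (simp add: c_def mult_ac power2_eq_square)
    moreover have "h x y * cnj (h x y) = of_real a"
      by (simp only: a_def complex_norm_square)
    ultimately have "Re (h z z) = Re (h x x) - 2 * t * a + t\<^sup>2 * a * Re (h y y)"
      by simp
    with pos[of z] show ?thesis by simp
  qed
  have "a \<ge> 0" by (simp add: a_def)
  show ?thesis
  proof (cases "Re (h y y) = 0")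
    case True
    \<comment> \<open>The quadratic polynomial degenerates to a linear one, which is bounded below only if it is constant.\<close>
    have "a = 0"
    proof (rule ccontr)
      assume "a \<noteq> 0"
      with \<open>a \<ge> 0\<close> have "0 < a" by simp
      have "0 \<le> Re (h x x) - 2 * ((Re (h x x) + 1) / (2 * a)) * a"
        using quad[of "(Re (h x x) + 1) / (2 * a)"] True by simp
      with \<open>0 < a\<close> show False by (simp add: field_simps)
    qed
    then show ?thesis by (simp add: a_def True)
  next
    case False
    with pos[of y] have "0 < Re (h y y)" by simp
    then show ?thesis
      \<comment> \<open>The minimum of the quadratic polynomial.\<close>
      using quad[of "1 / Re (h y y)"]
      by (simp add: a_def field_simps power2_eq_square)
  qed
qed

lemma cinner_add_left: "cinner (x + y) z = cinner x z + cinner y z"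
  by (metis cinner_add_right cinner_commute complex_cnj_add)

lemma cinner_scaleC_left: "cinner (c *\<^sub>C x) y = cnj c * cinner x y"
  by (metis cinner_scaleC_right cinner_commute complex_cnj_mult)

lemma cinner_zero_right [simp]: "cinner x 0 = 0"
  using cinner_add_right[of x 0 0] by simp

lemma cinner_zero_left [simp]: "cinner 0 x = 0"
  using cinner_add_left[of 0 0 x] by simp

lemma cinner_diff_right: "cinner x (y - z) = cinner x y - cinner x z"
  using cinner_add_right[of x "y - z" z] by simp

lemma cinner_sum_right: "cinner x (sum f A) = (\<Sum>a\<in>A. cinner x (f a))"
  by (induction A rule: infinite_finite_induct) (simp_all add: cinner_add_right)

lemma cinner_self: "cinner x x = of_real ((norm x)\<^sup>2)"
proof -
  obtain r where "cinner x x = of_real r" "r \<ge> 0"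
    using cinner_nonneg[of x] by (auto elim: nonneg_Reals_cases)
  then show ?thesis by (simp add: norm_eq_sqrt_cinner)
qed

lemma cinner_mult_swap: "cinner x y * cinner y x = of_real ((cmod (cinner x y))\<^sup>2)"
  by (subst (2) cinner_commute) (rule complex_norm_square[symmetric])

lemma norm_cinner_commute: "cmod (cinner x y) = cmod (cinner y x)"
  by (subst cinner_commute) simp

lemma norm_scaleC: "norm (c *\<^sub>C (x::'a::complex_inner)) = cmod c * norm x"
proof -
  have "cinner (c *\<^sub>C x) (c *\<^sub>C x) = (c * cnj c) * cinner x x"
    by (simp add: cinner_scaleC_left cinner_scaleC_right)
  then have "of_real ((norm (c *\<^sub>C x))\<^sup>2) = complex_of_real ((cmod c * norm x)\<^sup>2)"
    by (simp add: cinner_self power_mult_distrib flip: complex_norm_square)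
  then have "(norm (c *\<^sub>C x))\<^sup>2 = (cmod c * norm x)\<^sup>2"
    by (simp only: of_real_eq_iff)
  then show ?thesis
    by (rule power2_eq_imp_eq) auto
qed

lemma cinner_Cauchy_Schwarz: "cmod (cinner x y) \<le> norm x * norm (y::'a::complex_inner)"
proof -
  have "positive_form (cinner :: 'a \<Rightarrow> 'a \<Rightarrow> complex)"
    unfolding positive_form_def
    by (auto simp: cinner_add_right cinner_scaleC_right cinner_self intro: cinner_commute)
  then have "(cmod (cinner x y))\<^sup>2 \<le> (norm x * norm y)\<^sup>2"
    using positive_form_Cauchy_Schwarz[of cinner x y] by (simp add: cinner_self power_mult_distrib)
  then show ?thesis
    by (rule power2_le_imp_le) simp
qed

lemma bounded_linear_cinner_right: "bounded_linear (cinner (x::'a::complex_inner))"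
  by (rule bounded_linear_intro[where K = "norm x"])
    (auto simp: cinner_add_right scaleR_scaleC cinner_scaleC_right scaleR_conv_of_real
      mult.commute[of "norm x"] cinner_Cauchy_Schwarz[of x, unfolded mult.commute[of "norm x"]])

instance chilbert_space \<subseteq> banach ..

lemma bounded_clinear_scaleC: "bounded_clinear T \<Longrightarrow> T (c *\<^sub>C x) = c *\<^sub>C T x"
  and bounded_clinear_add: "bounded_clinear T \<Longrightarrow> T (x + y) = T x + T y"
  and bounded_clinear_diff: "bounded_clinear T \<Longrightarrow> T (x - y) = T x - T y"
  and bounded_clinear_zero: "bounded_clinear T \<Longrightarrow> T 0 = 0"
  unfolding bounded_clinear_def
  by (auto simp: linear_simps)

lemma bounded_clinearI:
  assumes "\<And>x y. T (x + y) = T x + T y" "\<And>c x. T (c *\<^sub>C x) = c *\<^sub>C T x"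
    and "\<And>x. norm (T x) \<le> K * norm x"
  shows "bounded_clinear T"
  unfolding bounded_clinear_def using assms
  by (auto intro!: bounded_linear_intro[where K = K] simp: scaleR_scaleC mult.commute)

lemma bounded_clinear_compose: "bounded_clinear S \<Longrightarrow> bounded_clinear T \<Longrightarrow> bounded_clinear (S \<circ> T)"
  unfolding bounded_clinear_def o_def by (auto intro: bounded_linear_compose)

lemma bounded_clinear_bound:
  assumes "bounded_clinear T" obtains K where "0 \<le> K" "\<And>x. norm (T x) \<le> K * norm x"
  using assms bounded_linear.nonneg_bounded[of T]
  unfolding bounded_clinear_def by (metis mult.commute)

lemma bounded_linear_scaleC: "bounded_linear (\<lambda>y::'a::complex_inner. c *\<^sub>C y)"
proof (rule bounded_linear_intro[where K = "cmod c"])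
  fix x y :: 'a and r :: real
  show "c *\<^sub>C (x + y) = c *\<^sub>C x + c *\<^sub>C y"
    by (rule scaleC_add_right)
  show "c *\<^sub>C (r *\<^sub>R x) = r *\<^sub>R (c *\<^sub>C x)"
    by (simp only: scaleR_scaleC scaleC_scaleC mult.commute)
  show "norm (c *\<^sub>C x) \<le> norm x * cmod c"
    by (simp add: norm_scaleC)
qed

section \<open>Orthonormal bases\<close>

text \<open>
  The component of \<open>x\<close> orthogonal to a finite part \<open>G\<close> of an orthonormal basis.
\<close>

definition residual :: "'h::chilbert_space set \<Rightarrow> 'h \<Rightarrow> 'h"
  where "residual G x = x - (\<Sum>e\<in>G. cinner e x *\<^sub>C e)"

lemma cinner_residual:
  assumes "is_onb E" "G \<subseteq> E" "finite G" "e \<in> G"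
  shows "cinner e (residual G x) = 0"
proof -
  have "cinner e (cinner f x *\<^sub>C f) = (if f = e then cinner e x else 0)" if "f \<in> G" for f
    using assms that unfolding is_onb_def
    by (auto simp: cinner_scaleC_right cinner_self subset_iff)
  then show ?thesis
    using assms(3,4) by (simp add: residual_def cinner_diff_right cinner_sum_right)
qed

lemma norm_residual:
  assumes "is_onb E" "G \<subseteq> E" "finite G"
  shows "(norm (residual G x))\<^sup>2 = (norm x)\<^sup>2 - (\<Sum>e\<in>G. (cmod (cinner e x))\<^sup>2)"
proof -
  define r where "r = residual G x"
  have x: "x = r + (\<Sum>e\<in>G. cinner e x *\<^sub>C e)"
    by (simp add: r_def residual_def)
  have "cinner r e = 0" if "e \<in> G" for e
    using cinner_residual[OF assms that] cinner_commute[of r e] by (simp add: r_def)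
  then have "cinner r x = cinner r r"
    by (subst x) (simp add: cinner_add_right cinner_sum_right cinner_scaleC_right)
  moreover have "cinner x x = cinner x r + (\<Sum>e\<in>G. cinner e x * cinner x e)"
    by (subst (2) x) (simp add: cinner_add_right cinner_sum_right cinner_scaleC_right)
  ultimately have "cinner x x = cnj (cinner r r) + (\<Sum>e\<in>G. of_real ((cmod (cinner e x))\<^sup>2))"
    by (metis (no_types, lifting) cinner_commute cinner_mult_swap sum.cong)
  then have "complex_of_real ((norm x)\<^sup>2)
      = of_real ((norm r)\<^sup>2 + (\<Sum>e\<in>G. (cmod (cinner e x))\<^sup>2))"
    by (simp add: cinner_self)
  then show ?thesis
    by (simp only: of_real_eq_iff r_def)
qed

lemma Bessel:
  assumes "is_onb E" "G \<subseteq> E" "finite G"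
  shows "(\<Sum>e\<in>G. (cmod (cinner e x))\<^sup>2) \<le> (norm x)\<^sup>2"
  using norm_residual[OF assms, of x] by (smt (verit) zero_le_power2)

lemma residual_add: "residual G (x + y) = residual G x + residual G y"
  and residual_scaleC: "residual G (c *\<^sub>C x) = c *\<^sub>C residual G x"
  by (simp_all add: residual_def cinner_add_right cinner_scaleC_right sum.distrib
      complex_vector.scale_left_distrib complex_vector.scale_right_diff_distrib
      complex_vector.scale_sum_right)

text \<open>
  A vector in the algebraic span uses only finitely many basis vectors, so its residual vanishes as
  soon as \<open>G\<close> contains them. Together with the contraction property \<open>norm_residual\<close> this makes the
  expansion in an orthonormal basis converge on the closure of the span.
\<close>

lemma residual_span:
  assumes "is_onb E" "y \<in> complex_vector.span E"
  shows "\<exists>F. finite F \<and> F \<subseteq> E \<and> (\<forall>G. finite G \<longrightarrow> F \<subseteq> G \<longrightarrow> G \<subseteq> E \<longrightarrow> residual G y = 0)"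
  using assms(2)
proof (induction rule: complex_vector.span_induct_alt)
  case base
  show ?case by (rule exI[of _ "{}"]) (simp add: residual_def)
next
  case (step c e y)
  then obtain F where F: "finite F" "F \<subseteq> E"
      "\<And>G. finite G \<Longrightarrow> F \<subseteq> G \<Longrightarrow> G \<subseteq> E \<Longrightarrow> residual G y = 0"
    by blast
  have e: "residual G e = 0" if "finite G" "e \<in> G" "G \<subseteq> E" for G
  proof -
    have "(\<Sum>f\<in>G. cinner f e *\<^sub>C f) = (\<Sum>f\<in>G. if f = e then e else 0)"
      using assms(1) that unfolding is_onb_def
      by (intro sum.cong) (auto simp: cinner_self subset_iff scaleC_one)
    then show ?thesis using that by (simp add: residual_def)
  qed
  show ?case
    using F step.hyps by (intro exI[of _ "insert e F"]) (auto simp: residual_add residual_scaleC e)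
qed

lemma onb_expansion:
  assumes "is_onb E"
  shows "((\<lambda>e. cinner e x *\<^sub>C e) has_sum x) E"
  unfolding has_sum_def tendsto_iff eventually_finite_subsets_at_top
proof (intro allI impI)
  fix \<epsilon> :: real assume "\<epsilon> > 0"
  moreover have "x \<in> closure (complex_vector.span E)"
    using assms by (simp add: is_onb_def)
  ultimately obtain y where y: "y \<in> complex_vector.span E" "dist y x < \<epsilon>"
    by (auto simp: closure_approachable)
  from residual_span[OF assms y(1)] obtain F where F: "finite F" "F \<subseteq> E"
      "\<And>G. finite G \<Longrightarrow> F \<subseteq> G \<Longrightarrow> G \<subseteq> E \<Longrightarrow> residual G y = 0"
    by blast
  have "dist (\<Sum>e\<in>G. cinner e x *\<^sub>C e) x < \<epsilon>" if G: "finite G" "F \<subseteq> G" "G \<subseteq> E" for G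
  proof -
    have "residual G x = residual G (x - y)"
      using residual_add[of G "x - y" y] F(3)[OF G] by simp
    moreover have "(norm (residual G (x - y)))\<^sup>2 \<le> (norm (x - y))\<^sup>2"
      unfolding norm_residual[OF assms G(3,1)] by (simp add: sum_nonneg)
    then have "norm (residual G (x - y)) \<le> norm (x - y)"
      by (rule power2_le_imp_le) simp
    ultimately have "norm (residual G x) < \<epsilon>"
      using y(2) by (simp add: dist_norm norm_minus_commute)
    then show ?thesis
      by (simp add: residual_def dist_norm norm_minus_commute)
  qed
  then show "\<exists>F. finite F \<and> F \<subseteq> E \<and> (\<forall>G. finite G \<and> F \<subseteq> G \<and> G \<subseteq> E \<longrightarrow> dist (\<Sum>e\<in>G. cinner e x *\<^sub>C e) x < \<epsilon>)"
    using F by blast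
qed

lemma Parseval:
  assumes "is_onb E"
  shows "((\<lambda>e. cinner x e * cinner e y) has_sum cinner x y) E"
  using has_sum_bounded_linear[OF bounded_linear_cinner_right onb_expansion[OF assms, of y], of x]
  by (simp add: cinner_scaleC_right mult.commute)

section \<open>Nuclear operators\<close>

text \<open>
  Absolutely convergent sums of rank one operators. Unlike the definition of \<open>trace_class\<close>, this form
  is visibly stable under composition with bounded operators on either side.
\<close>

definition nuclear_rep :: "('h::chilbert_space \<Rightarrow> 'h) \<Rightarrow> (nat \<Rightarrow> 'h) \<Rightarrow> (nat \<Rightarrow> 'h) \<Rightarrow> bool"
  where "nuclear_rep T u v \<longleftrightarrow>
    summable (\<lambda>n. norm (u n) * norm (v n)) \<and> (\<forall>x. (\<lambda>n. cinner (u n) x *\<^sub>C v n) sums T x)"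

definition adjoint_pair :: "('h::chilbert_space \<Rightarrow> 'h) \<Rightarrow> ('h \<Rightarrow> 'h) \<Rightarrow> bool"
  where "adjoint_pair S R \<longleftrightarrow>
    bounded_clinear S \<and> bounded_clinear R \<and> (\<forall>x y. cinner y (S x) = cinner (R y) x)"

lemma norm_rank_one: "norm (cinner u x *\<^sub>C (v::'h::chilbert_space)) \<le> norm u * norm v * norm x"
  using mult_right_mono[OF cinner_Cauchy_Schwarz[of u x] norm_ge_zero[of v]]
  by (simp add: norm_scaleC mult_ac)

lemma nuclear_rep_abs_summable:
  assumes "summable (\<lambda>n. norm (u n) * norm (v n :: 'h::chilbert_space))"
  shows "summable (\<lambda>n. norm (cinner (u n) x *\<^sub>C v n))"
  by (rule summable_comparison_test'[OF summable_mult2[OF assms, of "norm x"]])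
    (use norm_rank_one in auto)

lemma nuclear_rep_bounded_clinear:
  assumes "nuclear_rep T u v" shows "bounded_clinear T"
proof (rule bounded_clinearI)
  from assms have s: "summable (\<lambda>n. norm (u n) * norm (v n))"
    and T: "\<And>x. (\<lambda>n. cinner (u n) x *\<^sub>C v n) sums T x"
    unfolding nuclear_rep_def by blast+
  show "T (x + y) = T x + T y" for x y
  proof -
    have "(\<lambda>n. cinner (u n) (x + y) *\<^sub>C v n) sums (T x + T y)"
      using sums_add[OF T[of x] T[of y]] by (simp add: cinner_add_right scaleC_add_left)
    from sums_unique2[OF T this] show ?thesis .
  qed
  show "T (c *\<^sub>C x) = c *\<^sub>C T x" for c x
  proof -
    have "bounded_linear (\<lambda>y::'a. c *\<^sub>C y)"
      by (rule bounded_linear_scaleC)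
    from bounded_linear.sums[OF this T[of x]]
    have "(\<lambda>n. cinner (u n) (c *\<^sub>C x) *\<^sub>C v n) sums (c *\<^sub>C T x)"
      by (simp add: cinner_scaleC_right scaleC_scaleC)
    from sums_unique2[OF T this] show ?thesis .
  qed
  show "norm (T x) \<le> suminf (\<lambda>n. norm (u n) * norm (v n)) * norm x" for x
  proof -
    have "norm (T x) \<le> suminf (\<lambda>n. norm (cinner (u n) x *\<^sub>C v n))"
      using summable_norm[OF nuclear_rep_abs_summable[OF s]] by (simp add: sums_unique[OF T])
    also have "\<dots> \<le> suminf (\<lambda>n. norm (u n) * norm (v n) * norm x)"
      by (rule suminf_le[OF norm_rank_one nuclear_rep_abs_summable[OF s] summable_mult2[OF s]])
    finally show ?thesis by (simp add: suminf_mult2[OF s])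
  qed
qed

text \<open>
  The adjoint is the operator represented by the two sequences exchanged.
\<close>

lemma nuclear_rep_adjoint:
  assumes "nuclear_rep T u v"
  obtains R where "adjoint_pair T R"
proof -
  define R where "R y = suminf (\<lambda>n. cinner (v n) y *\<^sub>C u n)" for y
  from assms have s: "summable (\<lambda>n. norm (u n) * norm (v n))"
    and T: "\<And>x. (\<lambda>n. cinner (u n) x *\<^sub>C v n) sums T x"
    unfolding nuclear_rep_def by blast+
  have s': "summable (\<lambda>n. norm (v n) * norm (u n))"
    using s by (simp add: mult.commute)
  have R: "(\<lambda>n. cinner (v n) y *\<^sub>C u n) sums R y" for y
    unfolding R_def
    by (rule summable_sums, rule summable_norm_cancel, rule nuclear_rep_abs_summable[OF s'])
  have "nuclear_rep R v u"
    unfolding nuclear_rep_def using s' R by blast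
  moreover have "cinner y (T x) = cinner (R y) x" for x y
  proof -
    have "(\<lambda>n. cinner (u n) x * cinner y (v n)) sums cinner y (T x)"
      using bounded_linear.sums[OF bounded_linear_cinner_right T[of x], of y]
      by (simp add: cinner_scaleC_right)
    moreover have "(\<lambda>n. cnj (cinner (v n) y * cinner x (u n))) sums cnj (cinner x (R y))"
      using bounded_linear.sums[OF bounded_linear_cinner_right R[of y], of x]
      by (simp only: sums_cnj cinner_scaleC_right)
    then have "(\<lambda>n. cinner (u n) x * cinner y (v n)) sums cinner (R y) x"
      by (simp add: mult.commute flip: cinner_commute)
    ultimately show ?thesis by (rule sums_unique2)
  qed
  ultimately have "adjoint_pair T R"
    using nuclear_rep_bounded_clinear[of R v u] nuclear_rep_bounded_clinear[OF assms]
    unfolding adjoint_pair_def by blast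
  then show thesis by (rule that)
qed

lemma nuclear_rep_compose_left:
  assumes "nuclear_rep T u v" "bounded_clinear S"
  shows "nuclear_rep (S \<circ> T) u (S \<circ> v)"
proof -
  obtain K where K: "\<And>x. norm (S x) \<le> K * norm x"
    using bounded_clinear_bound[OF assms(2)] by blast
  have "bounded_linear S" using assms(2) by (simp add: bounded_clinear_def)
  moreover have "(\<lambda>n. cinner (u n) x *\<^sub>C v n) sums T x" for x
    using assms(1) by (simp add: nuclear_rep_def)
  ultimately have "(\<lambda>n. S (cinner (u n) x *\<^sub>C v n)) sums S (T x)" for x
    by (rule bounded_linear.sums)
  then have "\<forall>x. (\<lambda>n. cinner (u n) x *\<^sub>C S (v n)) sums S (T x)"
    by (simp only: bounded_clinear_scaleC[OF assms(2)] simp_thms)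
  moreover have "summable (\<lambda>n. norm (u n) * norm (S (v n)))"
  proof (rule summable_comparison_test')
    show "summable (\<lambda>n. norm (u n) * norm (v n) * K)"
      using assms(1) unfolding nuclear_rep_def by (rule summable_mult2[OF conjunct1])
    show "norm (norm (u n) * norm (S (v n))) \<le> norm (u n) * norm (v n) * K" for n
    proof -
      have "norm (u n) * norm (S (v n)) \<le> norm (u n) * (K * norm (v n))"
        by (rule mult_left_mono[OF K norm_ge_zero])
      also have "\<dots> = norm (u n) * norm (v n) * K"
        by (simp only: mult_ac)
      finally show ?thesis by (simp only: real_norm_def abs_mult abs_norm_cancel)
    qed
  qed
  ultimately show ?thesis unfolding nuclear_rep_def comp_apply by blast
qed

lemma nuclear_rep_compose_right:
  assumes "nuclear_rep T u v" "adjoint_pair S R"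
  shows "nuclear_rep (T \<circ> S) (R \<circ> u) v"
proof -
  have R: "bounded_clinear R" and adj: "\<And>x y. cinner (R y) x = cinner y (S x)"
    using assms(2) unfolding adjoint_pair_def by auto
  obtain K where K: "\<And>x. norm (R x) \<le> K * norm x"
    using bounded_clinear_bound[OF R] by blast
  have "\<forall>x. (\<lambda>n. cinner (R (u n)) x *\<^sub>C v n) sums T (S x)"
    using assms(1) unfolding nuclear_rep_def adj by blast
  moreover have "summable (\<lambda>n. norm (R (u n)) * norm (v n))"
  proof (rule summable_comparison_test')
    show "summable (\<lambda>n. norm (u n) * norm (v n) * K)"
      using assms(1) unfolding nuclear_rep_def by (rule summable_mult2[OF conjunct1])
    show "norm (norm (R (u n)) * norm (v n)) \<le> norm (u n) * norm (v n) * K" for n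
    proof -
      have "norm (R (u n)) * norm (v n) \<le> K * norm (u n) * norm (v n)"
        by (rule mult_right_mono[OF K norm_ge_zero])
      also have "\<dots> = norm (u n) * norm (v n) * K"
        by (simp only: mult_ac)
      finally show ?thesis by (simp only: real_norm_def abs_mult abs_norm_cancel)
    qed
  qed
  ultimately show ?thesis unfolding nuclear_rep_def comp_apply by blast
qed

section \<open>The trace\<close>

definition has_trace :: "('h::chilbert_space \<Rightarrow> 'h) \<Rightarrow> complex \<Rightarrow> bool"
  where "has_trace T t \<longleftrightarrow> (\<forall>E. is_onb E \<longrightarrow> ((\<lambda>e. cinner e (T e)) has_sum t) E)"

lemma Tr_eqI:
  fixes T :: "'h::chilbert_space \<Rightarrow> 'h" and E :: "'h set"
  assumes "has_trace T t" "is_onb E" shows "Tr T = t"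
  unfolding Tr_def
proof (rule the_equality)
  show "\<forall>E. is_onb E \<longrightarrow> ((\<lambda>e. cinner e (T e)) has_sum t) E"
    using assms(1) by (simp add: has_trace_def)
next
  fix s assume "\<forall>E. is_onb E \<longrightarrow> ((\<lambda>e. cinner e (T e)) has_sum s) E"
  then have "((\<lambda>e. cinner e (T e)) has_sum s) E"
    using assms(2) by blast
  moreover have "((\<lambda>e. cinner e (T e)) has_sum t) E"
    using assms unfolding has_trace_def by blast
  ultimately show "s = t"
    by (rule has_sum_unique)
qed

lemma has_trace_add:
  assumes "has_trace S s" "has_trace T t" shows "has_trace (\<lambda>x. S x + T x) (s + t)"
  using assms unfolding has_trace_def cinner_add_right
  by (intro allI impI has_sum_add) simp_all

lemma has_trace_scaleC:
  assumes "has_trace T t" shows "has_trace (\<lambda>x. c *\<^sub>C T x) (c * t)"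
  using assms unfolding has_trace_def cinner_scaleC_right
  by (intro allI impI has_sum_cmult_right) simp

lemma has_trace_sum:
  assumes "finite I" "\<And>i. i \<in> I \<Longrightarrow> has_trace (f i) (t i)"
  shows "has_trace (\<lambda>x. \<Sum>i\<in>I. f i x) (sum t I)"
  using assms
proof (induction I)
  case empty
  show ?case by (simp add: has_trace_def)
next
  case (insert i I)
  then have "has_trace (\<lambda>x. f i x + (\<Sum>i\<in>I. f i x)) (t i + sum t I)"
    by (intro has_trace_add) auto
  then show ?case using insert.hyps by simp
qed

text \<open>
  Bessel's inequality twice, combined by Cauchy-Schwarz: this is the bound that makes the double sum
  in the computation of the trace absolutely convergent.
\<close>

lemma sum_cinner_cinner_le:
  assumes "is_onb E" "G \<subseteq> E" "finite G"
  shows "(\<Sum>e\<in>G. cmod (cinner x e * cinner e y)) \<le> norm x * norm y"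
proof -
  have "(\<Sum>e\<in>G. cmod (cinner e x) * cmod (cinner e y)) \<le> L2_set (\<lambda>e. cmod (cinner e x)) G * L2_set (\<lambda>e. cmod (cinner e y)) G"
    using L2_set_mult_ineq[of "\<lambda>e. cmod (cinner e x)" "\<lambda>e. cmod (cinner e y)" G] by simp
  also have "\<dots> \<le> norm x * norm y"
  proof -
    have "L2_set (\<lambda>e. cmod (cinner e z)) G \<le> norm z" for z
      unfolding L2_set_def using Bessel[OF assms, of z] by (intro real_le_lsqrt) (auto intro: sum_nonneg)
    then show ?thesis
      by (intro mult_mono) auto
  qed
  finally show ?thesis
    by (simp add: norm_mult norm_cinner_commute[of x])
qed

text \<open>
  The double series of \<open>\<langle>u n, e\<rangle> \<langle>e, v n\<rangle>\<close> over \<open>n\<close> and \<open>e\<close> converges absolutely. Summing over \<open>e\<close>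
  first gives \<open>\<langle>u n, v n\<rangle>\<close> by Parseval, summing over \<open>n\<close> first gives \<open>\<langle>e, T e\<rangle>\<close>; the value does not
  mention the basis.
\<close>

lemma nuclear_rep_trace:
  assumes "nuclear_rep T u v"
  shows "has_trace T (suminf (\<lambda>n. cinner (u n) (v n)))"
  unfolding has_trace_def
proof (intro allI impI)
  fix E :: "'a set" assume E: "is_onb E"
  from assms have s: "summable (\<lambda>n. norm (u n) * norm (v n))"
    and T: "\<And>x. (\<lambda>n. cinner (u n) x *\<^sub>C v n) sums T x"
    unfolding nuclear_rep_def by blast+
  define g where "g = (\<lambda>(n, e). cinner (u n) e * cinner e (v n))"
  have row: "(\<lambda>e. norm (g (n, e))) summable_on E"
    and row_le: "(\<Sum>\<^sub>\<infinity>e\<in>E. norm (g (n, e))) \<le> norm (u n) * norm (v n)" for n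
  proof -
    have *: "sum (\<lambda>e. norm (g (n, e))) G \<le> norm (u n) * norm (v n)" if "finite G" "G \<subseteq> E" for G
      using sum_cinner_cinner_le[OF E that(2,1)] by (simp add: g_def)
    show "(\<lambda>e. norm (g (n, e))) summable_on E"
      by (rule nonneg_bdd_above_summable_on) (use * in \<open>auto intro!: bdd_aboveI\<close>)
    then show "(\<Sum>\<^sub>\<infinity>e\<in>E. norm (g (n, e))) \<le> norm (u n) * norm (v n)"
      by (rule infsum_le_finite_sums) (use * in auto)
  qed
  have "summable (\<lambda>n. norm (\<Sum>\<^sub>\<infinity>e\<in>E. norm (g (n, e))) :: real)"
    by (rule summable_comparison_test'[OF s]) (use row_le in \<open>auto simp: infsum_nonneg\<close>)
  then have "(\<lambda>n. \<Sum>\<^sub>\<infinity>e\<in>E. norm (g (n, e))) summable_on UNIV"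
    by (rule norm_summable_imp_summable_on)
  then have "(\<lambda>p. norm (g p)) summable_on UNIV \<times> E"
    using row by (subst Infinite_Sum.abs_summable_on_Sigma_iff) (simp add: infsum_nonneg)
  then obtain S where S: "(g has_sum S) (UNIV \<times> E)"
    using abs_summable_summable unfolding summable_on_def by blast
  have "((\<lambda>n. cinner (u n) (v n)) has_sum S) UNIV"
    by (rule has_sum_SigmaD[OF S]) (use Parseval[OF E] in \<open>simp add: g_def\<close>)
  then have "(\<lambda>n. cinner (u n) (v n)) sums S"
    by (rule has_sum_imp_sums)
  then have S_eq: "suminf (\<lambda>n. cinner (u n) (v n)) = S"
    by (simp add: sums_iff)
  have "((\<lambda>(e, n). g (n, e)) has_sum S) (E \<times> UNIV)"
    using S by (subst (asm) has_sum_swap)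
  then show "((\<lambda>e. cinner e (T e)) has_sum suminf (\<lambda>n. cinner (u n) (v n))) E"
    unfolding S_eq
  proof (rule has_sum_SigmaD)
    fix e
    have "((\<lambda>n. cinner (u n) e *\<^sub>C v n) has_sum T e) UNIV"
      by (rule norm_summable_imp_has_sum[OF nuclear_rep_abs_summable[OF s] T])
    from has_sum_bounded_linear[OF bounded_linear_cinner_right[of e] this]
    show "((\<lambda>n. (case (e, n) of (e, n) \<Rightarrow> g (n, e))) has_sum cinner e (T e)) UNIV"
      by (simp add: g_def cinner_scaleC_right)
  qed
qed

text \<open>
  With \<open>(u, v)\<close> representing \<open>T\<close> and \<open>R\<close> the adjoint of \<open>S\<close>, the product \<open>S \<circ> T\<close> is represented by
  \<open>(u, S \<circ> v)\<close> and \<open>T \<circ> S\<close> by \<open>(R \<circ> u, v)\<close>. Both have the trace \<open>(\<Sum>n. \<langle>u n, S (v n)\<rangle>)\<close>.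
\<close>

lemma nuclear_trace_commute:
  assumes "nuclear_rep S a b" "nuclear_rep T u v"
  obtains t where "has_trace (S \<circ> T) t" "has_trace (T \<circ> S) t"
proof -
  obtain R where R: "adjoint_pair S R"
    using nuclear_rep_adjoint[OF assms(1)] .
  then have adj: "cinner (R y) x = cinner y (S x)" for x y
    unfolding adjoint_pair_def by auto
  have "has_trace (S \<circ> T) (suminf (\<lambda>n. cinner (u n) (S (v n))))"
    using nuclear_rep_trace[OF nuclear_rep_compose_left[OF assms(2) nuclear_rep_bounded_clinear[OF assms(1)]]]
    unfolding comp_apply .
  moreover have "has_trace (T \<circ> S) (suminf (\<lambda>n. cinner (u n) (S (v n))))"
    using nuclear_rep_trace[OF nuclear_rep_compose_right[OF assms(2) R]]
    unfolding comp_apply adj .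
  ultimately show thesis by (rule that)
qed

section \<open>Trace class operators are nuclear\<close>

definition positive_op :: "('h::chilbert_space \<Rightarrow> 'h) \<Rightarrow> bool"
  where "positive_op Q \<longleftrightarrow> bounded_clinear Q \<and> positive_form (\<lambda>x y. cinner x (Q y))"

lemma positive_op_iff:
  "positive_op Q \<longleftrightarrow> bounded_clinear Q \<and>
     (\<forall>x y. cinner x (Q y) = cinner (Q x) y) \<and> (\<forall>x. 0 \<le> Re (cinner x (Q x)))"
proof -
  have sym: "cnj (cinner y (Q x)) = cinner (Q x) y" for x y
    by (rule cinner_commute[symmetric])
  have lin: "cinner x (Q (y + z)) = cinner x (Q y) + cinner x (Q z)"
      "cinner x (Q (c *\<^sub>C y)) = c * cinner x (Q y)" if "bounded_clinear Q" for x y z c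
    by (simp_all only: bounded_clinear_add[OF that] bounded_clinear_scaleC[OF that]
        cinner_add_right cinner_scaleC_right)
  show ?thesis
    unfolding positive_op_def positive_form_def sym using lin by blast
qed

text \<open>
  An operator with real quadratic form is symmetric, by polarization: test the form on \<open>x + y\<close> and on
  \<open>x + \<i> y\<close>.
\<close>

lemma abs_op_positive:
  assumes "is_abs_op P T" shows "positive_op P"
proof -
  from assms have P: "bounded_clinear P" and nonneg: "\<And>x. cinner x (P x) \<in> \<real>\<^sub>\<ge>\<^sub>0"
    unfolding is_abs_op_def by blast+
  have Im0: "Im (cinner x (P x)) = 0" and Re0: "0 \<le> Re (cinner x (P x))" for x
    using nonneg[of x] by (auto elim: nonneg_Reals_cases)
  have "cinner x (P y) = cinner (P x) y" for x y
  proof -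
    have "Im (cinner x (P y) + cinner y (P x)) = 0"
      using Im0[of "x + y"] Im0[of x] Im0[of y]
      by (simp add: bounded_clinear_add[OF P] cinner_add_left cinner_add_right)
    moreover have "Im (\<i> * cinner x (P y) - \<i> * cinner y (P x)) = 0"
      using Im0[of "x + \<i> *\<^sub>C y"] Im0[of x] Im0[of y]
      by (simp add: bounded_clinear_add[OF P] bounded_clinear_scaleC[OF P]
          cinner_add_left cinner_add_right cinner_scaleC_left cinner_scaleC_right)
    ultimately have "cinner x (P y) = cnj (cinner y (P x))"
      by (simp add: complex_eq_iff)
    then show ?thesis
      by (simp flip: cinner_commute)
  qed
  with P Re0 show ?thesis
    unfolding positive_op_iff by blast
qed

lemma abs_op_norm:
  assumes "is_abs_op P T" shows "norm (T x) = norm (P x)"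
proof -
  have "cinner (P x) (P x) = cinner (T x) (T x)"
    using assms abs_op_positive[OF assms] unfolding is_abs_op_def positive_op_iff by metis
  then have "(norm (P x))\<^sup>2 = (norm (T x))\<^sup>2"
    by (simp only: cinner_self of_real_eq_iff)
  then show ?thesis by simp
qed

lemma positive_op_eq_0:
  assumes "positive_op Q" "Re (cinner x (Q x)) = 0"
  shows "Q x = 0"
proof -
  have "(cmod (cinner (Q x) (Q x)))\<^sup>2 \<le> Re (cinner (Q x) (Q (Q x))) * Re (cinner x (Q x))"
    using assms(1) unfolding positive_op_def by (intro positive_form_Cauchy_Schwarz) blast
  with assms(2) have "cinner (Q x) (Q x) = 0" by simp
  then show ?thesis by (simp add: cinner_eq_zero_iff)
qed

lemma positive_opD:
  assumes "positive_op Q"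
  shows "bounded_clinear Q" "cinner x (Q y) = cinner (Q x) y" "0 \<le> Re (cinner x (Q x))"
  using assms unfolding positive_op_iff by blast+

text \<open>
  The multiple of \<open>e\<close> of length one for the form \<open>\<langle>x, Q y\<rangle>\<close>. If \<open>e\<close> has length zero for this form,
  division by zero yields the pivot \<open>0\<close>, and the elimination step below does nothing, as it should:
  then \<open>Q e = 0\<close> already.
\<close>

definition pivot :: "('h::chilbert_space \<Rightarrow> 'h) \<Rightarrow> 'h \<Rightarrow> 'h"
  where "pivot Q e = complex_of_real (1 / sqrt (Re (cinner e (Q e)))) *\<^sub>C e"

text \<open>
  Projection of \<open>x\<close> along \<open>e\<close> onto the complement of \<open>e\<close> that is orthogonal for the form
  \<open>\<langle>x, Q y\<rangle>\<close>. Composing \<open>Q\<close> with it subtracts from \<open>Q\<close> the rank one operator given by \<open>Q (pivot Q e)\<close>;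
  this is one step of Gaussian elimination, applied to the argument and not to \<open>Q\<close>, so that it can be
  carried out on another operator at the same time.
\<close>

definition eliminate :: "('h::chilbert_space \<Rightarrow> 'h) \<Rightarrow> 'h \<Rightarrow> 'h \<Rightarrow> 'h"
  where "eliminate Q e x = x - cinner (Q (pivot Q e)) x *\<^sub>C pivot Q e"

lemma pivot_le_1:
  assumes "positive_op Q"
  shows "Re (cinner (pivot Q e) (Q (pivot Q e))) \<le> 1"
proof -
  define k where "k = Re (cinner e (Q e))"
  have "k \<ge> 0" unfolding k_def by (rule positive_opD(3)[OF assms])
  have "Re (cinner (pivot Q e) (Q (pivot Q e))) = (1 / sqrt k) * (1 / sqrt k) * k"
    unfolding pivot_def bounded_clinear_scaleC[OF positive_opD(1)[OF assms]]
    by (simp add: cinner_scaleC_left cinner_scaleC_right flip: k_def)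
  also have "\<dots> \<le> 1"
    using \<open>k \<ge> 0\<close> by (simp add: field_simps)
  finally show ?thesis .
qed

lemma bounded_clinear_eliminate: "bounded_clinear (eliminate Q e)"
proof (rule bounded_clinearI)
  fix x y :: 'a and c :: complex
  show "eliminate Q e (x + y) = eliminate Q e x + eliminate Q e y"
    by (simp add: eliminate_def cinner_add_right scaleC_add_left)
  show "eliminate Q e (c *\<^sub>C x) = c *\<^sub>C eliminate Q e x"
    by (simp add: eliminate_def cinner_scaleC_right complex_vector.scale_right_diff_distrib)
  have "norm (eliminate Q e x) \<le> norm x + norm (cinner (Q (pivot Q e)) x *\<^sub>C pivot Q e)"
    unfolding eliminate_def by (rule norm_triangle_ineq4)
  also have "\<dots> \<le> norm x + norm (Q (pivot Q e)) * norm (pivot Q e) * norm x"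
    using norm_rank_one by simp
  finally show "norm (eliminate Q e x) \<le> (1 + norm (Q (pivot Q e)) * norm (pivot Q e)) * norm x"
    by (simp add: distrib_right)
qed

lemma eliminate_form:
  assumes "positive_op Q"
  shows "cinner y (Q (eliminate Q e x)) = cinner y (Q x) - cinner y (Q (pivot Q e)) * cinner (Q (pivot Q e)) x"
  unfolding eliminate_def bounded_clinear_diff[OF positive_opD(1)[OF assms]]
    bounded_clinear_scaleC[OF positive_opD(1)[OF assms]] cinner_diff_right cinner_scaleC_right
  by (simp only: mult.commute)

lemma eliminate_form_self:
  assumes "positive_op Q"
  shows "Re (cinner x (Q (eliminate Q e x))) = Re (cinner x (Q x)) - (cmod (cinner (Q (pivot Q e)) x))\<^sup>2"
  unfolding eliminate_form[OF assms] cinner_mult_swap norm_cinner_commute[of x] by simp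

text \<open>
  Positivity of the reduced operator is the Cauchy-Schwarz inequality for the form of \<open>Q\<close>, applied
  to the pivot.
\<close>

lemma positive_op_eliminate:
  assumes "positive_op Q"
  shows "positive_op (Q \<circ> eliminate Q e)"
  unfolding positive_op_iff
proof (intro conjI allI)
  define w where "w = pivot Q e"
  note sym = positive_opD(2)[OF assms]
  show "bounded_clinear (Q \<circ> eliminate Q e)"
    by (intro bounded_clinear_compose positive_opD(1)[OF assms] bounded_clinear_eliminate)
  show "cinner x ((Q \<circ> eliminate Q e) y) = cinner ((Q \<circ> eliminate Q e) x) y" for x y
  proof -
    have "cinner ((Q \<circ> eliminate Q e) x) y = cnj (cinner y (Q (eliminate Q e x)))"
      unfolding comp_apply by (rule cinner_commute)
    also have "\<dots> = cinner (Q x) y - cinner (Q w) y * cinner x (Q w)"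
      unfolding eliminate_form[OF assms] w_def[symmetric] complex_cnj_diff complex_cnj_mult
        cinner_commute[symmetric] ..
    finally show ?thesis
      unfolding comp_apply eliminate_form[OF assms] w_def[symmetric] sym[of x y]
      by (simp only: mult.commute)
  qed
  show "0 \<le> Re (cinner x ((Q \<circ> eliminate Q e) x))" for x
  proof -
    have "(cmod (cinner w (Q x)))\<^sup>2 \<le> Re (cinner w (Q w)) * Re (cinner x (Q x))"
      using assms unfolding positive_op_def by (intro positive_form_Cauchy_Schwarz) blast
    also have "\<dots> \<le> 1 * Re (cinner x (Q x))"
      unfolding w_def by (intro mult_right_mono pivot_le_1 assms positive_opD(3))
    finally show ?thesis
      unfolding comp_apply eliminate_form_self[OF assms] w_def[symmetric] sym[of w x] by simp
  qed
qed

lemma eliminate_self: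
  assumes "positive_op Q"
  shows "Q (eliminate Q e e) = 0"
proof (cases "Re (cinner e (Q e)) = 0")
  case True
  then show ?thesis
    using positive_op_eq_0[OF assms] by (simp add: eliminate_def pivot_def)
next
  case False
  define k where "k = Re (cinner e (Q e))"
  note Q = positive_opD(1)[OF assms]
  have "k > 0" using False positive_opD(3)[OF assms, of e] by (simp add: k_def)
  have "cinner (Q e) e = cnj (cinner (Q e) e)"
    using cinner_commute[of e "Q e"] positive_opD(2)[OF assms, of e e] by simp
  then have Qe: "cinner (Q e) e = of_real k"
    unfolding k_def positive_opD(2)[OF assms] by (simp add: complex_eq_iff)
  have scalar: "cnj (complex_of_real a) * of_real k * of_real a = of_real (a * k * a)" for a
    by simp
  have "cinner (Q (pivot Q e)) e *\<^sub>C pivot Q e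
      = complex_of_real ((1 / sqrt k) * k * (1 / sqrt k)) *\<^sub>C e"
    unfolding pivot_def k_def[symmetric] bounded_clinear_scaleC[OF Q] cinner_scaleC_left scaleC_scaleC
      Qe scalar ..
  also have "\<dots> = e"
    using \<open>k > 0\<close> by (simp add: scaleC_one)
  finally show ?thesis
    unfolding eliminate_def by (simp add: bounded_clinear_zero[OF Q])
qed

lemma eliminate_kernel:
  assumes "positive_op Q" "Q x = 0"
  shows "eliminate Q e x = x"
  using assms(2) positive_opD(2)[OF assms(1), of "pivot Q e" x] by (simp add: eliminate_def)

primrec eliminations :: "('h::chilbert_space \<Rightarrow> 'h) \<Rightarrow> (nat \<Rightarrow> 'h) \<Rightarrow> nat \<Rightarrow> 'h \<Rightarrow> 'h"
  where
    "eliminations P e 0 = id"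
  | "eliminations P e (Suc n) = eliminations P e n \<circ> eliminate (P \<circ> eliminations P e n) (e n)"

text \<open>
  The vectors \<open>P (cholesky_vector P e n)\<close> are the columns of the Cholesky factor of \<open>P\<close>.
\<close>

definition cholesky_vector :: "('h::chilbert_space \<Rightarrow> 'h) \<Rightarrow> (nat \<Rightarrow> 'h) \<Rightarrow> nat \<Rightarrow> 'h"
  where "cholesky_vector P e n = eliminations P e n (pivot (P \<circ> eliminations P e n) (e n))"

lemma bounded_clinear_eliminations: "bounded_clinear (eliminations P e n)"
proof (induction n)
  case 0
  show ?case by (rule bounded_clinearI[where K = 1]) auto
next
  case (Suc n)
  then show ?case by (simp add: bounded_clinear_compose bounded_clinear_eliminate del: comp_apply)
qed

lemma eliminations_eq_sum:
  "eliminations P e N x = x - (\<Sum>n<N. cinner (P (cholesky_vector P e n)) x *\<^sub>C cholesky_vector P e n)"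
proof (induction N)
  case (Suc N)
  have "eliminations P e (Suc N) x
      = eliminations P e N x - cinner (P (cholesky_vector P e N)) x *\<^sub>C cholesky_vector P e N"
    unfolding eliminations.simps comp_apply eliminate_def cholesky_vector_def
      bounded_clinear_diff[OF bounded_clinear_eliminations]
      bounded_clinear_scaleC[OF bounded_clinear_eliminations] ..
  with Suc.IH show ?case by simp
qed simp

context
  fixes P :: "'h::chilbert_space \<Rightarrow> 'h" and e :: "nat \<Rightarrow> 'h"
  assumes P: "positive_op P"
begin

lemma positive_op_eliminations: "positive_op (P \<circ> eliminations P e n)"
proof (induction n)
  case 0
  then show ?case using P by simp
next
  case (Suc n)
  from positive_op_eliminate[OF this] show ?case by (simp only: eliminations.simps comp_assoc)
qed

lemma eliminations_form:
  "Re (cinner x (P (eliminations P e N x)))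
    = Re (cinner x (P x)) - (\<Sum>n<N. (cmod (cinner (P (cholesky_vector P e n)) x))\<^sup>2)"
proof (induction N)
  case (Suc N)
  then show ?case
    using eliminate_form_self[OF positive_op_eliminations[of N], of x "e N"]
    by (simp add: cholesky_vector_def)
qed simp

text \<open>
  Elimination never spoils what has been achieved: a vector in the kernel of the reduced operator is
  orthogonal to every pivot for its form, so the next step fixes it.
\<close>

lemma eliminations_kernel:
  assumes "P (eliminations P e n x) = 0" "n \<le> N"
  shows "P (eliminations P e N x) = 0"
  using assms(2)
proof (induction rule: dec_induct)
  case base
  show ?case by (rule assms(1))
next
  case (step N)
  then show ?case
    using eliminate_kernel[OF positive_op_eliminations[of N], of x "e N"] by simp
qed

lemma eliminations_pivot: "n < N \<Longrightarrow> P (eliminations P e N (e n)) = 0"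
  using eliminations_kernel[of "Suc n" "e n" N] eliminate_self[OF positive_op_eliminations[of n], of "e n"]
  by simp

text \<open>
  The reduced operators \<open>Q\<close> satisfy \<open>0 \<le> \<langle>y, Q y\<rangle> \<le> \<langle>y, P y\<rangle>\<close>. Cauchy-Schwarz for the form of \<open>Q\<close>, at
  \<open>x\<close> and \<open>z = Q x\<close>, turns this into a bound for \<open>Q\<close> that is uniform in the number of steps.
\<close>

lemma eliminations_bound:
  assumes K: "0 \<le> K" "\<And>x. norm (P x) \<le> K * norm x"
  shows "norm (P (eliminations P e N x)) \<le> K * norm x"
proof -
  define z where "z = P (eliminations P e N x)"
  have form_le: "Re (cinner y (P (eliminations P e N y))) \<le> K * (norm y)\<^sup>2" for y
  proof -
    have "Re (cinner y (P (eliminations P e N y))) \<le> Re (cinner y (P y))"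
      unfolding eliminations_form by (simp add: sum_nonneg)
    also have "\<dots> \<le> norm y * norm (P y)"
      using cinner_Cauchy_Schwarz complex_Re_le_cmod order_trans by blast
    also have "\<dots> \<le> norm y * (K * norm y)"
      by (intro mult_left_mono K) simp
    finally show ?thesis by (simp add: power2_eq_square mult_ac)
  qed
  have z_norm: "cmod (cinner z z) = (norm z)\<^sup>2"
    unfolding cinner_self norm_of_real by simp
  have "(cmod (cinner z z))\<^sup>2 \<le> Re (cinner z (P (eliminations P e N z))) * Re (cinner x (P (eliminations P e N x)))"
    using positive_op_eliminations[of N] positive_form_Cauchy_Schwarz[of _ z x]
    unfolding positive_op_def by (auto simp: z_def)
  also have "\<dots> \<le> (K * (norm z)\<^sup>2) * (K * (norm x)\<^sup>2)"
    using positive_opD(3)[OF positive_op_eliminations[of N]] form_le K(1)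
    by (intro mult_mono) auto
  finally have le: "(norm z)\<^sup>2 * (norm z)\<^sup>2 \<le> (norm z)\<^sup>2 * (K * norm x)\<^sup>2"
    by (simp only: z_norm power_mult_distrib power2_eq_square mult_ac)
  have "norm z \<le> K * norm x"
  proof (cases "z = 0")
    case False
    then have "0 < (norm z)\<^sup>2" by simp
    with le have "(norm z)\<^sup>2 \<le> (K * norm x)\<^sup>2"
      by (rule mult_left_le_imp_le)
    then show ?thesis
      by (rule power2_le_imp_le) (simp add: K(1))
  qed (simp add: K(1))
  then show ?thesis by (simp only: z_def)
qed

text \<open>
  On the span of the basis the reduced operators are eventually zero, since they annihilate the
  kernel of \<open>P\<close> and every basis vector already eliminated; the uniform bound carries the limit over to the closure.
\<close>

lemma eliminations_tendsto_0:
  assumes "closure (complex_vector.span E) = UNIV"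
    and E: "\<And>f. f \<in> E \<Longrightarrow> f \<in> range e \<or> P f = 0"
  shows "(\<lambda>N. P (eliminations P e N x)) \<longlonglongrightarrow> 0"
proof -
  have Pb: "bounded_clinear (P \<circ> eliminations P e N)" for N
    by (rule positive_opD(1)[OF positive_op_eliminations])
  have span: "\<exists>M. \<forall>N\<ge>M. P (eliminations P e N y) = 0" if "y \<in> complex_vector.span E" for y
    using that
  proof (induction rule: complex_vector.span_induct_alt)
    case base
    show ?case using bounded_clinear_zero[OF Pb] by simp
  next
    case (step c f y)
    obtain M where M: "\<forall>N\<ge>M. P (eliminations P e N y) = 0" using step.IH by blast
    obtain M' where M': "\<forall>N\<ge>M'. P (eliminations P e N f) = 0"
    proof (cases "P f = 0")
      case True
      then show thesis using eliminations_kernel[of 0 f] that by auto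
    next
      case False
      then obtain n where "f = e n" using E step.hyps by blast
      then show thesis using eliminations_pivot[of n] that[of "Suc n"] by auto
    qed
    show ?case
      using M M' bounded_clinear_add[OF Pb] bounded_clinear_scaleC[OF Pb]
      by (intro exI[of _ "max M M'"]) simp
  qed
  obtain K where K: "0 \<le> K" "\<And>x. norm (P x) \<le> K * norm x"
    using bounded_clinear_bound[OF positive_opD(1)[OF P]] by blast
  show ?thesis
  proof (rule LIMSEQ_I)
    fix r :: real assume "r > 0"
    then have "r / (K + 1) > 0" using K(1) by simp
    moreover have "x \<in> closure (complex_vector.span E)" using assms(1) by simp
    ultimately obtain y where y: "y \<in> complex_vector.span E" "dist y x < r / (K + 1)"
      unfolding closure_approachable by blast
    obtain M where M: "\<forall>N\<ge>M. P (eliminations P e N y) = 0" using span[OF y(1)] by blast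
    have "norm (P (eliminations P e N x) - 0) < r" if "N \<ge> M" for N
    proof -
      have "P (eliminations P e N x) = P (eliminations P e N (x - y))"
        using M that bounded_clinear_diff[OF Pb, of N x y] by simp
      then have "norm (P (eliminations P e N x)) \<le> K * norm (x - y)"
        using eliminations_bound[OF K] by simp
      also have "\<dots> \<le> (K + 1) * norm (x - y)"
        by (simp add: distrib_right)
      also have "\<dots> < r"
        using y(2) K(1) by (simp add: dist_norm norm_minus_commute field_simps)
      finally show ?thesis by simp
    qed
    then show "\<exists>M. \<forall>N\<ge>M. norm (P (eliminations P e N x) - 0) < r" by blast
  qed
qed

text \<open>
  By Parseval the sum of the squared norms of finitely many columns is the trace of the part of \<open>P\<close>
  that has been eliminated, and the rest is positive.
\<close>

lemma cholesky_norm_sum_le: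
  assumes E: "is_onb E" and s: "(\<lambda>f. Re (cinner f (P f))) summable_on E"
  shows "(\<Sum>n<N. (norm (P (cholesky_vector P e n)))\<^sup>2) \<le> (\<Sum>\<^sub>\<infinity>f\<in>E. Re (cinner f (P f)))"
proof (rule has_sum_mono)
  have norm_sum: "((\<lambda>f. (cmod (cinner r f))\<^sup>2) has_sum (norm r)\<^sup>2) E" for r
  proof -
    have "((\<lambda>f. complex_of_real ((cmod (cinner r f))\<^sup>2)) has_sum of_real ((norm r)\<^sup>2)) E"
      using Parseval[OF E, of r r] unfolding cinner_mult_swap cinner_self .
    then show ?thesis
      by (simp only: has_sum_of_real_iff)
  qed
  show "((\<lambda>f. \<Sum>n<N. (cmod (cinner (P (cholesky_vector P e n)) f))\<^sup>2) has_sum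
      (\<Sum>n<N. (norm (P (cholesky_vector P e n)))\<^sup>2)) E"
  proof (induction N)
    case (Suc N)
    from has_sum_add[OF this norm_sum] show ?case
      by (simp only: sum.lessThan_Suc)
  qed simp
  show "((\<lambda>f. Re (cinner f (P f))) has_sum (\<Sum>\<^sub>\<infinity>f\<in>E. Re (cinner f (P f)))) E"
    using s by (rule has_sum_infsum)
  show "(\<Sum>n<N. (cmod (cinner (P (cholesky_vector P e n)) f))\<^sup>2) \<le> Re (cinner f (P f))" for f
    using eliminations_form[of f N] positive_opD(3)[OF positive_op_eliminations[of N], of f]
    by simp
qed

end

text \<open>
  The elimination is driven by \<open>P = |T|\<close> and carried out on both operators. A convergent sum has only
  countably many nonzero terms, so all but countably many basis vectors are annihilated by \<open>P\<close>, and the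
  others can be enumerated; adding \<open>0\<close> to them avoids an empty list and adds only a trivial step.
\<close>

lemma trace_class_nuclear:
  assumes "trace_class T"
  obtains u v where "nuclear_rep T u v"
proof -
  from assms obtain P E where T: "bounded_clinear T" and abs: "is_abs_op P T" and E: "is_onb E"
    and s: "(\<lambda>f. cinner f (P f)) summable_on E"
    unfolding trace_class_def by blast
  have P: "positive_op P" by (rule abs_op_positive[OF abs])
  have s_Re: "(\<lambda>f. Re (cinner f (P f))) summable_on E"
    using s by (rule summable_on_Re)
  have "countable (insert 0 {f \<in> E. cinner f (P f) \<noteq> 0})"
    using summable_countable_complex[OF s] by simp
  from range_from_nat_into[OF insert_not_empty this]
  obtain e :: "nat \<Rightarrow> 'a" where e: "range e = insert 0 {f \<in> E. cinner f (P f) \<noteq> 0}"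
    by (rule that)
  define w where "w = cholesky_vector P e"
  have norm_eq: "norm (T x) = norm (P x)" for x
    by (rule abs_op_norm[OF abs])
  have "summable (\<lambda>n. (norm (P (w n)))\<^sup>2)"
    unfolding w_def
    by (rule summableI_nonneg_bounded[OF zero_le_power2 cholesky_norm_sum_le[OF P E s_Re]])
  then have "summable (\<lambda>n. norm (P (w n)) * norm (T (w n)))"
    unfolding norm_eq power2_eq_square .
  moreover have "(\<lambda>n. cinner (P (w n)) x *\<^sub>C T (w n)) sums T x" for x
  proof -
    have "linear T"
      using T by (simp add: bounded_clinear_def bounded_linear.linear)
    then have remainder: "T (eliminations P e N x) = T x - (\<Sum>n<N. cinner (P (w n)) x *\<^sub>C T (w n))" for N
      unfolding eliminations_eq_sum w_def bounded_clinear_diff[OF T]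
      by (simp only: linear_sum bounded_clinear_scaleC[OF T])
    have "f \<in> range e \<or> P f = 0" if "f \<in> E" for f
      using that positive_op_eq_0[OF P, of f] unfolding e by auto
    then have "(\<lambda>N. P (eliminations P e N x)) \<longlonglongrightarrow> 0"
      using E by (intro eliminations_tendsto_0[OF P, of E]) (auto simp: is_onb_def)
    then have "(\<lambda>N. norm (T (eliminations P e N x))) \<longlonglongrightarrow> 0"
      unfolding norm_eq by (rule tendsto_norm_zero)
    then have "(\<lambda>N. T x - (\<Sum>n<N. cinner (P (w n)) x *\<^sub>C T (w n))) \<longlonglongrightarrow> 0"
      unfolding remainder by (rule tendsto_norm_zero_cancel)
    from tendsto_diff[OF tendsto_const[of "T x"] this] show ?thesis
      by (simp add: sums_def)
  qed
  ultimately have "nuclear_rep T (\<lambda>n. P (w n)) (\<lambda>n. T (w n))"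
    unfolding nuclear_rep_def by blast
  then show thesis by (rule that)
qed

section \<open>Functionals on the free algebra that depend on cyclic words only\<close>

text \<open>
  The linear extension of a function on words to the free algebra. It is applied to the trace of the
  operator obtained from a word, with the value 0 at the empty word, since the identity operator
  has no trace in general.
\<close>

definition word_functional :: "(indet list \<Rightarrow> complex) \<Rightarrow> ncpoly \<Rightarrow> complex"
  where "word_functional \<tau> p = (\<Sum>w\<in>Poly_Mapping.keys p.
    complex_of_real (of_rat (Poly_Mapping.lookup p w)) * \<tau> (letters w))"

lemma word_functional_superset:
  assumes "finite W" "Poly_Mapping.keys p \<subseteq> W"
  shows "word_functional \<tau> p = (\<Sum>w\<in>W. complex_of_real (of_rat (Poly_Mapping.lookup p w)) * \<tau> (letters w))"
  unfolding word_functional_def using assms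
  by (intro sum.mono_neutral_left) (auto simp: in_keys_iff)

lemma word_functional_add:
  "word_functional \<tau> (p + q) = word_functional \<tau> p + word_functional \<tau> q"
proof -
  define W where "W = Poly_Mapping.keys p \<union> Poly_Mapping.keys q"
  have "finite W" "Poly_Mapping.keys p \<subseteq> W" "Poly_Mapping.keys q \<subseteq> W" "Poly_Mapping.keys (p + q) \<subseteq> W"
    using Poly_Mapping.keys_add[of p q] by (auto simp: W_def)
  then show ?thesis
    by (simp add: word_functional_superset[of W] lookup_add of_rat_add distrib_right sum.distrib)
qed

lemma word_functional_zero: "word_functional \<tau> 0 = 0"
  by (simp add: word_functional_def)

lemma word_functional_scaleQ:
  "word_functional \<tau> (scaleQ c p) = complex_of_real (of_rat c) * word_functional \<tau> p"
proof -
  have "Poly_Mapping.keys (scaleQ c p) \<subseteq> Poly_Mapping.keys p"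
    by (auto simp: in_keys_iff lookup_scaleQ)
  then show ?thesis
    by (simp add: word_functional_superset[of "Poly_Mapping.keys p"] lookup_scaleQ of_rat_mult
        sum_distrib_left mult.assoc)
qed

lemma word_functional_sum:
  "word_functional \<tau> (sum f I) = (\<Sum>i\<in>I. word_functional \<tau> (f i))"
  by (induction I rule: infinite_finite_induct) (simp_all add: word_functional_zero word_functional_add)

lemma word_functional_diff:
  "word_functional \<tau> (p - q) = word_functional \<tau> p - word_functional \<tau> q"
  using word_functional_add[of \<tau> "p - q" q] by simp

lemma word_functional_single:
  "word_functional \<tau> (Poly_Mapping.single w c) = complex_of_real (of_rat c) * \<tau> (letters w)"
  by (simp add: word_functional_def)

lemma sum_lookup_single: "(\<Sum>w\<in>Poly_Mapping.keys p. Poly_Mapping.single w (Poly_Mapping.lookup p w)) = p"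
proof (rule poly_mapping_eqI)
  fix k
  show "Poly_Mapping.lookup (\<Sum>w\<in>Poly_Mapping.keys p. Poly_Mapping.single w (Poly_Mapping.lookup p w)) k
      = Poly_Mapping.lookup p k"
    by (simp add: lookup_sum lookup_single when_def in_keys_iff)
qed

lemma ncpoly_mult_expand:
  "(p * q :: ncpoly) = (\<Sum>u\<in>Poly_Mapping.keys p. \<Sum>v\<in>Poly_Mapping.keys q.
     Poly_Mapping.single (u + v) (Poly_Mapping.lookup p u * Poly_Mapping.lookup q v))"
proof -
  have "p * q = (\<Sum>u\<in>Poly_Mapping.keys p. Poly_Mapping.single u (Poly_Mapping.lookup p u)) *
      (\<Sum>v\<in>Poly_Mapping.keys q. Poly_Mapping.single v (Poly_Mapping.lookup q v))"
    by (simp only: sum_lookup_single)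
  then show ?thesis
    by (simp only: sum_product mult_single)
qed

text \<open>
  A function on words that is invariant under cyclic rotation extends to a functional that cannot
  distinguish \<open>u * v\<close> from \<open>v * u\<close>, as one sees on monomials.
\<close>

lemma word_functional_commutators:
  assumes cyc: "\<And>u v. \<tau> (u @ v) = \<tau> (v @ u)" and p: "p \<in> sums_of_commutators"
  shows "word_functional \<tau> p = 0"
  using p unfolding sums_of_commutators_def
proof (induction rule: ncpoly.span_induct_alt)
  case base
  show ?case by (rule word_functional_zero)
next
  case (step c x y)
  then obtain u v where x: "x = u * v - v * u" by blast
  have mult: "word_functional \<tau> (p * q) = (\<Sum>u\<in>Poly_Mapping.keys p. \<Sum>v\<in>Poly_Mapping.keys q.
     complex_of_real (of_rat (Poly_Mapping.lookup p u * Poly_Mapping.lookup q v)) * \<tau> (letters u @ letters v))" for p q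
    unfolding ncpoly_mult_expand word_functional_sum word_functional_single plus_free_monoid_def
      free_monoid.sel ..
  have "word_functional \<tau> (u * v) = word_functional \<tau> (v * u)"
    unfolding mult by (subst sum.swap) (simp only: cyc mult.commute)
  with step.IH show ?case
    by (simp add: x word_functional_add word_functional_scaleQ word_functional_diff)
qed

section \<open>Polynomials without constant term\<close>

text \<open>
  A polynomial without constant term evaluates to a trace class operator at trace class operators.
  The polynomials without
  constant term form a left ideal, which covers the products and powers below.
\<close>

lemma constant_coeff_mult:
  assumes "Poly_Mapping.lookup q (0 :: indet free_monoid) = (0::rat)"
  shows "Poly_Mapping.lookup (p * q) 0 = 0"
proof -
  have "u + v \<noteq> 0" if "v \<in> Poly_Mapping.keys q" for u v
    using that assms by (cases v) (auto simp: plus_free_monoid_def zero_free_monoid_def)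
  then show ?thesis
    unfolding ncpoly_mult_expand lookup_sum lookup_single by (simp add: when_def)
qed

lemma constant_coeff_power:
  "1 \<le> j \<Longrightarrow> Poly_Mapping.lookup q (0 :: indet free_monoid) = (0::rat) \<Longrightarrow> Poly_Mapping.lookup (q ^ j) 0 = 0"
  by (cases j) (simp_all add: power_Suc2 constant_coeff_mult del: power_Suc)

lemma constant_coeff_vars:
  "Poly_Mapping.lookup var_a 0 = 0" "Poly_Mapping.lookup var_b 0 = 0"
  by (simp_all add: var_a_def var_b_def lookup_single when_def zero_free_monoid_def)

lemma constant_coeff_y_poly: "1 \<le> j \<Longrightarrow> Poly_Mapping.lookup (y_poly \<xi> j) 0 = 0"
proof -
  assume "1 \<le> j"
  then obtain i where j: "j = Suc i" by (cases j) auto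
  have "y_poly \<xi> j = y_poly \<xi> i * y_factor \<xi> j"
    by (simp add: y_poly_def j)
  moreover have "Poly_Mapping.lookup (y_factor \<xi> j) 0 = 0"
    by (simp add: y_factor_def lookup_add constant_coeff_vars constant_coeff_mult)
  ultimately show ?thesis by (simp only: constant_coeff_mult)
qed

lemma constant_coeff_X_poly: "Poly_Mapping.lookup (X_poly m) 0 = 0"
  unfolding X_poly_def lookup_sum lookup_scaleQ
  by (intro sum.neutral ballI) (simp add: constant_coeff_y_poly)

lemma constant_coeff_Xt_poly: "Poly_Mapping.lookup (Xt_poly m) 0 = 0"
  unfolding Xt_poly_def lookup_sum lookup_scaleQ
  by (intro sum.neutral ballI)
    (simp add: lookup_minus lookup_add constant_coeff_vars constant_coeff_mult constant_coeff_power)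

section \<open>Words in trace class operators\<close>

lemma word_op_append: "word_op A B (u @ v) = word_op A B u \<circ> word_op A B v"
proof (induction u)
  case (Cons x u)
  then show ?case by (cases x) (simp_all add: comp_assoc)
qed simp

lemma word_op_nuclear:
  assumes A: "nuclear_rep A a a'" and B: "nuclear_rep B b b'" and "w \<noteq> []"
  shows "\<exists>u v. nuclear_rep (word_op A B w) u v"
  using assms(3)
proof (induction w)
  case (Cons x w)
  show ?case
  proof (cases "w = []")
    case True
    then show ?thesis using A B by (cases x) auto
  next
    case False
    with Cons.IH obtain u v where uv: "nuclear_rep (word_op A B w) u v" by blast
    show ?thesis
      using nuclear_rep_compose_left[OF uv nuclear_rep_bounded_clinear[OF A]]
        nuclear_rep_compose_left[OF uv nuclear_rep_bounded_clinear[OF B]]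
      by (cases x) (simp_all only: word_op.simps, blast+)
  qed
qed simp

text \<open>
  On polynomials without constant term the trace is a functional of the kind treated above: every
  word that occurs is nonempty, hence nuclear, and rotation of words is commutation of nuclear factors.
\<close>

lemma Tr_ncpoly_op_cong:
  fixes A B :: "'h::chilbert_space \<Rightarrow> 'h"
  assumes A: "trace_class A" and B: "trace_class B"
    and p: "Poly_Mapping.lookup p 0 = 0" and q: "Poly_Mapping.lookup q 0 = 0"
    and pq: "p - q \<in> sums_of_commutators"
  shows "Tr (ncpoly_op p A B) = Tr (ncpoly_op q A B)"
proof -
  obtain a a' where a: "nuclear_rep A a a'" using trace_class_nuclear[OF A] .
  obtain b b' where b: "nuclear_rep B b b'" using trace_class_nuclear[OF B] .
  obtain E :: "'h set" where E: "is_onb E" using A unfolding trace_class_def by blast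
  define \<tau> where "\<tau> w = (if w = [] then 0 else Tr (word_op A B w))" for w
  have trace_word: "has_trace (word_op A B w) (\<tau> w)" if "w \<noteq> []" for w
  proof -
    obtain u v where "nuclear_rep (word_op A B w) u v"
      using word_op_nuclear[OF a b \<open>w \<noteq> []\<close>] by blast
    from nuclear_rep_trace[OF this] show ?thesis
      using Tr_eqI[OF _ E] that unfolding \<tau>_def by auto
  qed
  have cyc: "\<tau> (v @ w) = \<tau> (w @ v)" for v w
  proof (cases "v = [] \<or> w = []")
    case False
    then have "v \<noteq> []" "w \<noteq> []" by auto
    then obtain s s' r r' where "nuclear_rep (word_op A B v) s s'" "nuclear_rep (word_op A B w) r r'"
      using word_op_nuclear[OF a b] by metis
    then obtain t where "has_trace (word_op A B (v @ w)) t" "has_trace (word_op A B (w @ v)) t"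
      unfolding word_op_append by (rule nuclear_trace_commute)
    then show ?thesis
      using False by (simp add: \<tau>_def Tr_eqI[OF _ E])
  qed auto
  have Tr_eq: "Tr (ncpoly_op f A B) = word_functional \<tau> f" if f: "Poly_Mapping.lookup f 0 = 0" for f
  proof (rule Tr_eqI[OF _ E])
    have "letters w \<noteq> []" if "w \<in> Poly_Mapping.keys f" for w
      using that f by (cases w) (auto simp: zero_free_monoid_def)
    then have "has_trace (\<lambda>x. \<Sum>w\<in>Poly_Mapping.keys f.
        complex_of_real (of_rat (Poly_Mapping.lookup f w)) *\<^sub>C word_op A B (letters w) x) (word_functional \<tau> f)"
      unfolding word_functional_def
      by (intro has_trace_sum has_trace_scaleC trace_word) auto
    then show "has_trace (ncpoly_op f A B) (word_functional \<tau> f)"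
      unfolding ncpoly_op_def .
  qed
  show ?thesis
    using word_functional_commutators[of \<tau>, OF cyc pq] unfolding Tr_eq[OF p] Tr_eq[OF q] word_functional_diff
    by simp
qed

theorem theorem3:
  fixes m :: nat
  assumes "m \<ge> 1"
  shows "(separable_space (euclidean :: 'h::chilbert_space topology) \<longrightarrow>
           (\<forall>A B :: 'h \<Rightarrow> 'h. trace_class A \<longrightarrow> trace_class B \<longrightarrow>
              Tr (ncpoly_op (X_poly m) A B) = Tr (ncpoly_op (Xt_poly m) A B))) \<and>
         Xt_poly m - X_poly m \<in> sums_of_commutators"
proof (intro conjI impI allI)
  show difference: "Xt_poly m - X_poly m \<in> sums_of_commutators"
    by (rule Xt_poly_comm_eq_X_poly)
  show "Tr (ncpoly_op (X_poly m) A B) = Tr (ncpoly_op (Xt_poly m) A B)"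
    if "trace_class A" "trace_class B" for A B :: "'h \<Rightarrow> 'h"
    using Tr_ncpoly_op_cong[OF that constant_coeff_Xt_poly constant_coeff_X_poly difference] ..
qed

end
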